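(* Let $\mathbf{T}=\{z\in\mathbb{C}:|z|=1\}$, let $\rho>-1/4$, and let $Q:\mathbf{T}\to\mathbb{R}$ be a function such that $x\mapsto Q(e^{ix})-\rho x^{2}$ is convex on $\mathbb{R}$. Put $I^{Q}:=\inf_{\nu\in\mathcal{P}(\mathbf{T})}E^{Q}(\nu)$, where $$E^{Q}(\nu)=\int_{\mathbf{T}} Q(z)\,\nu(dz)-\iint_{\mathbf{T}\times\mathbf{T}}\log|z-z'|\,\nu(dz)\,\nu(dz').$$ If $\nu_{Q}\in\mathcal{P}(\mathbf{T})$ is a solution of this minimization problem (i.e. $E^{Q}(\nu_{Q})=I^{Q}$), then for every $\nu\in\mathcal{P}(\mathbf{T})$, $$\left(\rho+\tfrac14\right)\bigl(W_{2}(\nu,\nu_{Q})\bigr)^{2}\le E^{Q}(\nu)-I^{Q}.$$ In particular, the minimization problem $\inf_{\nu\in\mathcal{P}(\mathbf{T})}E^{Q}(\nu)$ has a unique solution.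
   Context: $\mathcal{P}(\mathbf{T})$ is the set of all Borel probability measures on $\mathbf{T}$. The Wasserstein distance is $W_{2}(\mu,\nu)=\sqrt{\inf_{\pi\in\Pi(\mu,\nu)}\iint|x-y|^{2}\,d\pi(x,y)}$, where $\Pi(\mu,\nu)$ is the set of probability measures on $\mathbf{T}\times\mathbf{T}$ with marginals $\mu$ and $\nu$ and $|x-y|$ is the absolute value of the difference in $\mathbb{C}$. $E^{Q}$ takes values in $(-\infty,+\infty]$, with $-\log 0=+\infty$. *)

theory Defs
  imports "HOL-Probability.Probability"
begin

abbreviation circle :: "complex set" (\<open>\<bbbT>\<close>)
  where "circle \<equiv> sphere 0 1"

definition borel_prob_measures :: "'a::topological_space set \<Rightarrow> 'a measure set"
  where "borel_prob_measures S =
    {\<mu>. prob_space \<mu> \<and> sets \<mu> = sets (restrict_space borel S)}"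

text \<open>
  The Lebesgue integral of an extended-real-valued function, as the integral of the positive part
  minus the integral of the negative part. The notion is meaningful when at least one of the two
  is finite (on \<^typ>\<open>ereal\<close> the library sets \<open>\<infinity> - \<infinity> = \<infinity>\<close>). This is always the case below, since
  \<open>log \<bar>z - z'\<bar>\<close> is bounded above by \<open>log 2\<close> on the circle.
\<close>
definition ereal_integral :: "'a measure \<Rightarrow> ('a \<Rightarrow> ereal) \<Rightarrow> ereal"
  where "ereal_integral M f =
    enn2ereal (\<integral>\<^sup>+x. e2ennreal (max 0 (f x)) \<partial>M) -
    enn2ereal (\<integral>\<^sup>+x. e2ennreal (max 0 (- f x)) \<partial>M)"

text \<open>The logarithm on \<open>[0, \<infinity>)\<close> with \<open>log 0 = -\<infinity>\<close> (the library has \<open>ln 0 = 0\<close>).\<close>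
definition elog :: "real \<Rightarrow> ereal"
  where "elog x = (if x = 0 then -\<infinity> else ereal (ln x))"

definition energy :: "(complex \<Rightarrow> real) \<Rightarrow> complex measure \<Rightarrow> ereal"
  where "energy Q \<nu> =
    ereal (\<integral>z. Q z \<partial>\<nu>) -
    ereal_integral (\<nu> \<Otimes>\<^sub>M \<nu>) (\<lambda>(z, z'). elog (cmod (z - z')))"

definition min_energy :: "(complex \<Rightarrow> real) \<Rightarrow> ereal"
  where "min_energy Q = (INF \<nu>\<in>borel_prob_measures \<bbbT>. energy Q \<nu>)"

definition couplings :: "complex measure \<Rightarrow> complex measure \<Rightarrow> (complex \<times> complex) measure set"
  where "couplings \<mu> \<nu> =
    {\<pi> \<in> borel_prob_measures (\<bbbT> \<times> \<bbbT>).
      distr \<pi> (restrict_space borel \<bbbT>) fst = \<mu> \<and>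
      distr \<pi> (restrict_space borel \<bbbT>) snd = \<nu>}"

definition W2 :: "complex measure \<Rightarrow> complex measure \<Rightarrow> real"
  where "W2 \<mu> \<nu> =
    sqrt (INF \<pi>\<in>couplings \<mu> \<nu>. \<integral>(x, y). (cmod (x - y))\<^sup>2 \<partial>\<pi>)"

end

theory Submission
  imports Defs
begin

text \<open>
  Put \<open>K u = - ln \<bar>sin (u / 2)\<bar>\<close>, so that \<open>- ln \<bar>e\<^sup>i\<^sup>a - e\<^sup>i\<^sup>b\<bar> = K (a - b) - ln 2\<close>. Since \<open>K'' \<ge> 1 / 4\<close> on
  \<open>(0, 2 \<pi>)\<close>, the energy is displacement convex along monotone lifts. The quantile functions of two
  measures \<open>\<nu>\<close> and \<open>\<nu>\<^sub>Q\<close> extend to monotone \<open>X\<close>, \<open>Y\<close> on the line with \<open>X (s + 1) = X s + 2 \<pi>\<close>, and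
  after a rotation of the parameter \<open>D = X - Y\<close> has mean zero. For such lifts all differences
  \<open>X s - X s'\<close>, \<open>Y s - Y s'\<close> with \<open>s' \<le> s \<le> s' + 1\<close> lie in \<open>[0, 2 \<pi>]\<close>, so along
  \<open>(1 - t) Y + t X\<close> the interaction gains
  \<open>t (1 - t) / 8 \<integral>\<integral> (D s - D s')\<^sup>2 = t (1 - t) / 4 \<integral> D\<^sup>2\<close> and the potential gains \<open>\<rho> t (1 - t) \<integral> D\<^sup>2\<close>.
  Comparing with the minimum and letting \<open>t \<rightarrow> 0\<close> gives \<open>(\<rho> + 1 / 4) \<integral> D\<^sup>2 \<le> E(\<nu>) - I\<close>, which implies
  both the transport inequality and uniqueness. Existence is the direct method: Skorohod
  representation of a convergent subsequence of angle distributions, and Fatou's lemma.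
\<close>

section \<open>The logarithmic kernel\<close>

lemma cmod_cis_diff: "cmod (cis a - cis b) = 2 * \<bar>sin ((a - b) / 2)\<bar>"
proof -
  have half: "2 * ((a - b) / 2) = a - b" by simp
  have "(cmod (cis a - cis b))\<^sup>2 = (cos a - cos b)\<^sup>2 + (sin a - sin b)\<^sup>2"
    by (simp add: cmod_power2)
  also have "\<dots> = 2 - 2 * cos (a - b)"
    using sin_cos_squared_add[of a] sin_cos_squared_add[of b]
    by (simp add: cos_diff power2_eq_square algebra_simps)
  also have "\<dots> = (2 * \<bar>sin ((a - b) / 2)\<bar>)\<^sup>2"
    using cos_double_sin[of "(a - b) / 2", unfolded half] by (simp add: power_mult_distrib)
  finally show ?thesis
    by (rule power2_eq_imp_eq) auto
qed

text \<open>A chord is at most its arc. The cost in \<open>W2\<close> is chordal, and this bound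
  lets it be estimated by an integral over angles.\<close>

lemma cmod_cis_diff_le: "cmod (cis a - cis b) \<le> \<bar>a - b\<bar>"
  using abs_sin_le_one abs_sin_x_le_abs_x[of "(a - b) / 2"] by (simp add: cmod_cis_diff)

text \<open>Dropping the factor 2 of the chord length makes the kernel nonnegative, so with values
  in \<open>ennreal\<close> Tonelli and Fatou apply directly. The explicit infinite branch overrides
  the convention \<open>ln 0 = 0\<close>.\<close>

definition log_kernel :: "real \<Rightarrow> ennreal"
  where "log_kernel u = (if sin (u / 2) = 0 then \<infinity> else ennreal (- ln \<bar>sin (u / 2)\<bar>))"

lemma log_kernel_measurable [measurable]: "log_kernel \<in> borel_measurable borel"
  unfolding log_kernel_def by measurable

lemma log_kernel_minus: "log_kernel (- u) = log_kernel u"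
  by (simp add: log_kernel_def)

lemma log_kernel_abs: "log_kernel \<bar>u\<bar> = log_kernel u"
  by (cases "u \<ge> 0") (simp_all add: log_kernel_minus)

text \<open>Continuity into [0, \<infinity>] covers the singular points: there the sine tends to 0,
  so its modulus drops below \<open>exp (- l)\<close> and the kernel exceeds every \<open>l\<close>.
  The Fatou argument uses this where limit points collide.\<close>

lemma tendsto_log_kernel:
  assumes "(f \<longlongrightarrow> u) F"
  shows "((\<lambda>x. log_kernel (f x)) \<longlongrightarrow> log_kernel u) F"
proof (cases "sin (u / 2) = 0")
  case False
  have s: "((\<lambda>x. sin (f x / 2)) \<longlongrightarrow> sin (u / 2)) F"
    by (rule isCont_tendsto_compose[OF _ assms, of "\<lambda>v. sin (v / 2)"]) auto
  have "((\<lambda>x. ennreal (- ln \<bar>sin (f x / 2)\<bar>)) \<longlongrightarrow> ennreal (- ln \<bar>sin (u / 2)\<bar>)) F"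
    by (intro tendsto_ennrealI tendsto_minus tendsto_ln tendsto_rabs s) (use False in auto)
  moreover have "\<forall>\<^sub>F x in F. ennreal (- ln \<bar>sin (f x / 2)\<bar>) = log_kernel (f x)"
    using tendsto_imp_eventually_ne[OF s False] by eventually_elim (simp add: log_kernel_def)
  ultimately show ?thesis
    using False by (simp add: log_kernel_def tendsto_cong)
next
  case True
  have s: "((\<lambda>x. \<bar>sin (f x / 2)\<bar>) \<longlongrightarrow> \<bar>sin (u / 2)\<bar>) F"
    by (rule isCont_tendsto_compose[OF _ assms, of "\<lambda>v. \<bar>sin (v / 2)\<bar>"]) auto
  have "((\<lambda>x. log_kernel (f x)) \<longlongrightarrow> \<infinity>) F"
    unfolding infinity_ennreal_def tendsto_top_iff_ennreal
  proof safe
    fix l :: real assume l: "0 \<le> l"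
    have "\<forall>\<^sub>F x in F. \<bar>sin (f x / 2)\<bar> < exp (- l)"
      using order_tendstoD(2)[OF s, of "exp (- l)"] True by simp
    then show "\<forall>\<^sub>F x in F. ennreal l < log_kernel (f x)"
    proof eventually_elim
      case (elim x)
      show ?case
      proof (cases "sin (f x / 2) = 0")
        case False
        then have "ln \<bar>sin (f x / 2)\<bar> < - l"
          using elim ln_less_cancel_iff[of "\<bar>sin (f x / 2)\<bar>" "exp (- l)"] by simp
        then show ?thesis
          using False l by (simp add: log_kernel_def ennreal_less_iff)
      qed (simp add: log_kernel_def)
    qed
  qed
  then show ?thesis
    using True by (simp add: log_kernel_def)
qed

text \<open>The second derivative of - ln (sin (u / 2)) is 1 / (4 sin^2 (u / 2)) \<ge> 1/4, and that
  of u^2 / 8 is 1/4. This is the source of the constant 1/4 in the theorem.\<close>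

lemma convex_on_neg_ln_sin:
  "convex_on {0<..<2 * pi} (\<lambda>u. - ln (sin (u / 2)) - u\<^sup>2 / 8)"
proof (rule f''_ge0_imp_convex)
  show "convex {0<..<2 * pi :: real}" by simp
  fix u assume "u \<in> {0<..<2 * pi :: real}"
  then have s: "sin (u / 2) > 0"
    by (intro sin_gt_zero) auto
  show "((\<lambda>u. - ln (sin (u / 2)) - u\<^sup>2 / 8) has_real_derivative
      - (cos (u / 2) / (2 * sin (u / 2))) - u / 4) (at u)"
    using s by (auto intro!: derivative_eq_intros simp: field_simps)
  show "((\<lambda>u. - (cos (u / 2) / (2 * sin (u / 2))) - u / 4) has_real_derivative
      1 / (4 * (sin (u / 2))\<^sup>2) - 1 / 4) (at u)"
  proof -
    have *: "cos (u / 2) * cos (u / 2) = 1 - sin (u / 2) * sin (u / 2)"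
      using sin_cos_squared_add[of "u / 2"] by (simp add: power2_eq_square)
    show ?thesis
      using s by (auto intro!: derivative_eq_intros simp: field_simps power2_eq_square *)
  qed
  have "(sin (u / 2))\<^sup>2 \<le> 1"
    by (simp add: abs_square_le_1)
  then show "0 \<le> 1 / (4 * (sin (u / 2))\<^sup>2) - 1 / 4"
    using s by (simp add: field_simps)
qed

lemma log_kernel_eq_top_endpoints:
  assumes "0 \<le> u" "u \<le> 2 * pi" "u \<notin> {0<..<2 * pi}"
  shows "log_kernel u = \<infinity>"
proof -
  have "u = 0 \<or> u = 2 * pi" using assms by auto
  then show ?thesis by (auto simp: log_kernel_def)
qed

text \<open>Turns convexity after subtraction of a quadratic into a quantitative gain; applied both
  to the kernel and to the potential.\<close>

lemma convex_square_defect: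
  fixes a b t :: real
  shows "(1 - t) * a\<^sup>2 + t * b\<^sup>2 = ((1 - t) * a + t * b)\<^sup>2 + t * (1 - t) * (a - b)\<^sup>2"
  by (simp add: power2_eq_square algebra_simps)

text \<open>At an endpoint of [0, 2 pi] the kernel is infinite, and as t and 1 - t are positive, so
  is the right side. In the interior the gain is the convexity defect of u^2 / 8.\<close>

lemma log_kernel_strongly_convex:
  assumes "0 \<le> a" "a \<le> 2 * pi" "0 \<le> b" "b \<le> 2 * pi" and t: "0 < t" "t < 1"
  shows "log_kernel ((1 - t) * a + t * b) + ennreal (t * (1 - t) * (a - b)\<^sup>2 / 8)
       \<le> ennreal (1 - t) * log_kernel a + ennreal t * log_kernel b"
proof (cases "a \<in> {0<..<2 * pi} \<and> b \<in> {0<..<2 * pi}")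
  case False
  then have "log_kernel a = \<infinity> \<or> log_kernel b = \<infinity>"
    using assms log_kernel_eq_top_endpoints by blast
  then show ?thesis
    using t by (auto simp: ennreal_mult_top)
next
  case True
  define c where "c = (1 - t) * a + t * b"
  have c: "c \<in> {0<..<2 * pi}"
    using convexD_alt[of "{0<..<2 * pi}" a b t] True t by (simp add: c_def)
  have K: "log_kernel u = ennreal (- ln (sin (u / 2)))" "- ln (sin (u / 2)) \<ge> 0"
    if "u \<in> {0<..<2 * pi}" for u
  proof -
    have "sin (u / 2) > 0" using that by (intro sin_gt_zero) auto
    then show "log_kernel u = ennreal (- ln (sin (u / 2)))" "- ln (sin (u / 2)) \<ge> 0"
      by (simp_all add: log_kernel_def)
  qed
  have "- ln (sin (c / 2)) - c\<^sup>2 / 8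
      \<le> (1 - t) * (- ln (sin (a / 2)) - a\<^sup>2 / 8) + t * (- ln (sin (b / 2)) - b\<^sup>2 / 8)"
    using convex_onD[OF convex_on_neg_ln_sin, of t a b] True t by (simp add: c_def)
  also have "\<dots> = (1 - t) * - ln (sin (a / 2)) + t * - ln (sin (b / 2))
      - ((1 - t) * a\<^sup>2 + t * b\<^sup>2) / 8"
    by (simp add: field_simps)
  also note convex_square_defect[of t a b, folded c_def]
  finally have "- ln (sin (c / 2)) + t * (1 - t) * (a - b)\<^sup>2 / 8
      \<le> (1 - t) * - ln (sin (a / 2)) + t * - ln (sin (b / 2))"
    by (simp add: field_simps)
  then have "ennreal (- ln (sin (c / 2)) + t * (1 - t) * (a - b)\<^sup>2 / 8)
      \<le> ennreal ((1 - t) * - ln (sin (a / 2)) + t * - ln (sin (b / 2)))"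
    by (rule ennreal_leI)
  also have "ennreal (- ln (sin (c / 2)) + t * (1 - t) * (a - b)\<^sup>2 / 8)
      = ennreal (- ln (sin (c / 2))) + ennreal (t * (1 - t) * (a - b)\<^sup>2 / 8)"
    using K(2)[OF c] t by (intro ennreal_plus) auto
  also have "ennreal ((1 - t) * - ln (sin (a / 2)) + t * - ln (sin (b / 2)))
      = ennreal (1 - t) * ennreal (- ln (sin (a / 2))) + ennreal t * ennreal (- ln (sin (b / 2)))"
  proof -
    have nn: "0 \<le> (1 - t) * - ln (sin (a / 2))" "0 \<le> t * - ln (sin (b / 2))"
      using K(2) True t by (intro mult_nonneg_nonneg; simp)+
    show ?thesis
      unfolding ennreal_plus[OF nn] using t by (subst (1 2) ennreal_mult') auto
  qed
  finally show ?thesis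
    using K(1) True c by (simp add: c_def)
qed

section \<open>Energy in terms of angles\<close>

text \<open>\<open>Arg\<close> jumps across the negative real axis but is constant on it, so it is
  glued from its continuous branch and a two-valued function on the closed half line.\<close>

lemma Arg_measurable [measurable]: "Arg \<in> borel_measurable borel"
proof -
  have "(\<lambda>z. if z \<in> \<real>\<^sub>\<le>\<^sub>0 then (if z = 0 then 0 else pi) else Arg z) \<in> borel_measurable borel"
  proof (subst measurable_If_restrict_space_iff)
    show "(\<lambda>z::complex. if z = 0 then 0 else pi) \<in> borel_measurable (restrict_space borel {z. z \<in> \<real>\<^sub>\<le>\<^sub>0}) \<and>
        Arg \<in> borel_measurable (restrict_space borel {z. z \<notin> \<real>\<^sub>\<le>\<^sub>0})"
    proof
      show "(\<lambda>z::complex. if z = 0 then 0 else pi) \<in> borel_measurable (restrict_space borel {z. z \<in> \<real>\<^sub>\<le>\<^sub>0})"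
        by (intro measurable_restrict_space1 measurable_If) auto
      show "Arg \<in> borel_measurable (restrict_space borel {z. z \<notin> \<real>\<^sub>\<le>\<^sub>0})"
        by (intro borel_measurable_continuous_on_restrict continuous_at_imp_continuous_on)
           (auto intro: continuous_at_Arg)
    qed
  qed auto
  also have "(\<lambda>z. if z \<in> \<real>\<^sub>\<le>\<^sub>0 then (if z = 0 then 0 else pi) else Arg z) = Arg"
  proof
    fix z show "(if z \<in> \<real>\<^sub>\<le>\<^sub>0 then (if z = 0 then 0 else pi) else Arg z) = Arg z"
    proof (cases "z \<in> \<real>\<^sub>\<le>\<^sub>0 \<and> z \<noteq> 0")
      case True
      then have "Re z < 0 \<and> Im z = 0"
        by (auto simp: complex_nonpos_Reals_iff complex_eq_iff)
      then have "Arg z = pi" by (simp add: Arg_eq_pi)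
      with True show ?thesis by simp
    qed (auto simp: Arg_zero)
  qed
  finally show ?thesis .
qed

abbreviation circle_borel :: "complex measure"
  where "circle_borel \<equiv> restrict_space borel circle"

definition arc_law :: "'a measure \<Rightarrow> ('a \<Rightarrow> real) \<Rightarrow> complex measure"
  where "arc_law M Y = distr M circle_borel (\<lambda>s. cis (Y s))"

lemma cis_measurable_circle [measurable (raw)]:
  assumes "Y \<in> borel_measurable M"
  shows "(\<lambda>s. cis (Y s)) \<in> measurable M circle_borel"
proof (rule measurable_restrict_space2)
  have "cis \<in> borel_measurable borel"
    by (rule borel_measurable_continuous_onI[OF continuous_on_cis[OF continuous_on_id]])
  then show "(\<lambda>s. cis (Y s)) \<in> borel_measurable M"
    using assms by (rule measurable_compose[rotated])
qed simp

lemma arc_law_in_borel_prob_measures: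
  assumes "prob_space M" "Y \<in> borel_measurable M"
  shows "arc_law M Y \<in> borel_prob_measures circle"
  using assms by (auto simp: borel_prob_measures_def arc_law_def intro!: prob_space.prob_space_distr)

lemma cis_Arg_unit: "cmod z = 1 \<Longrightarrow> cis (Arg z) = z"
  using cis_Arg[of z] by (cases "z = 0") (auto simp: sgn_div_norm)

text \<open>Regularity of \<open>Q\<close> is known only through angles; on the circle
  \<open>Q\<close> factors as \<open>Q (cis (Arg z))\<close>.\<close>

lemma borel_measurable_on_circle:
  assumes "continuous_on UNIV (\<lambda>x. Q (cis x))"
  shows "(Q :: complex \<Rightarrow> real) \<in> borel_measurable circle_borel"
proof -
  have "(\<lambda>z. Q (cis (Arg z))) \<in> borel_measurable circle_borel"
    using borel_measurable_continuous_onI[OF assms]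
    by (intro measurable_restrict_space1 measurable_compose[OF Arg_measurable])
  then show ?thesis
    by (rule measurable_cong[THEN iffD1, rotated])
       (auto simp: space_restrict_space cis_Arg_unit)
qed

definition interaction :: "'a measure \<Rightarrow> ('a \<Rightarrow> real) \<Rightarrow> ennreal"
  where "interaction M Y = (\<integral>\<^sup>+(s, s'). log_kernel (Y s - Y s') \<partial>(M \<Otimes>\<^sub>M M))"

text \<open>This is K u = ln 2 - r with the positive and negative parts of r moved to opposite
  sides: subtraction in \<open>ennreal\<close> truncates, and r may be -\<infinity>.\<close>

lemma log_kernel_add_elog:
  fixes u :: real
  defines "r \<equiv> elog (2 * \<bar>sin (u / 2)\<bar>)"
  shows "log_kernel u + e2ennreal (max 0 r) = ennreal (ln 2) + e2ennreal (max 0 (- r))"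
proof (cases "sin (u / 2) = 0")
  case True
  then show ?thesis by (simp add: r_def elog_def log_kernel_def)
next
  case False
  define w where "w = ln \<bar>sin (u / 2)\<bar>"
  have w: "w \<le> 0" using False by (simp add: w_def)
  have r: "r = ereal (ln 2 + w)"
    using False by (simp add: r_def elog_def w_def ln_mult)
  have K: "log_kernel u = ennreal (- w)"
    using False by (simp add: log_kernel_def w_def)
  have e: "e2ennreal (max 0 (ereal x)) = ennreal (max 0 x)" for x
    by (simp add: max_def e2ennreal_ereal flip: zero_ereal_def)
  show ?thesis
    unfolding K r uminus_ereal.simps e using w
    by (cases "0 \<le> ln 2 + w") (simp_all add: max_def flip: ennreal_plus)
qed

lemma e2ennreal_elog_chord_le: "e2ennreal (max 0 (elog (2 * \<bar>sin u\<bar>))) \<le> ennreal (ln 2)"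
proof -
  have "elog (2 * \<bar>sin u\<bar>) \<le> ereal (ln 2)"
    by (auto simp: elog_def ln_mult)
  then have "e2ennreal (max 0 (elog (2 * \<bar>sin u\<bar>))) \<le> e2ennreal (ereal (ln 2))"
    by (intro e2ennreal_mono) (simp add: max_def)
  then show ?thesis by simp
qed

text \<open>Pulling the double integral back to the parameter space turns chord lengths into sines
  of half angle differences. The factor 2 of the chord contributes ln 2 exactly once because the
  product measure has mass 1.\<close>

lemma (in prob_space) energy_arc_law:
  assumes [measurable]: "Y \<in> borel_measurable M"
    and Q: "continuous_on UNIV (\<lambda>x. Q (cis x))"
  shows "energy Q (arc_law M Y)
       = ereal ((\<integral>s. Q (cis (Y s)) \<partial>M) - ln 2) + enn2ereal (interaction M Y)"
proof -
  let ?N = "arc_law M Y" and ?P = "M \<Otimes>\<^sub>M M"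
  interpret P: prob_space ?P
    by (intro prob_space_pair prob_space_axioms)
  interpret N: prob_space ?N
    unfolding arc_law_def by (intro prob_space_distr) measurable
  have pair: "?N \<Otimes>\<^sub>M ?N = distr ?P (circle_borel \<Otimes>\<^sub>M circle_borel) (\<lambda>(s, s'). (cis (Y s), cis (Y s')))"
    using N.sigma_finite_measure_axioms unfolding arc_law_def
    by (intro pair_measure_distr) auto
  define e where "e s s' = elog (2 * \<bar>sin ((Y s - Y s') / 2)\<bar>)" for s s'
  have [measurable]: "elog \<in> borel_measurable borel"
    unfolding elog_def by measurable
  have [measurable]: "(\<lambda>(z, z'). elog (cmod (z - z'))) \<in> borel_measurable (circle_borel \<Otimes>\<^sub>M circle_borel)"
  proof -
    have [measurable]: "(\<lambda>z. z) \<in> borel_measurable circle_borel"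
      by (intro measurable_restrict_space1) auto
    show ?thesis by measurable
  qed
  have [measurable]: "(\<lambda>x. e (fst x) (snd x)) \<in> borel_measurable ?P"
    unfolding e_def by measurable
  have push: "(\<integral>\<^sup>+x. f (case x of (z, z') \<Rightarrow> elog (cmod (z - z'))) \<partial>(?N \<Otimes>\<^sub>M ?N))
      = (\<integral>\<^sup>+x. f (e (fst x) (snd x)) \<partial>?P)" if [measurable]: "f \<in> borel_measurable borel" for f :: "ereal \<Rightarrow> ennreal"
    unfolding pair by (subst nn_integral_distr) (auto simp: case_prod_beta e_def cmod_cis_diff)
  define p n where "p = (\<integral>\<^sup>+x. e2ennreal (max 0 (e (fst x) (snd x))) \<partial>?P)"
    and "n = (\<integral>\<^sup>+x. e2ennreal (max 0 (- e (fst x) (snd x))) \<partial>?P)"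
  have eint: "ereal_integral (?N \<Otimes>\<^sub>M ?N) (\<lambda>(z, z'). elog (cmod (z - z'))) = enn2ereal p - enn2ereal n"
    unfolding ereal_integral_def p_def n_def by (subst (1 2) push) auto
  have "interaction M Y + p = (\<integral>\<^sup>+x. log_kernel (Y (fst x) - Y (snd x)) + e2ennreal (max 0 (e (fst x) (snd x))) \<partial>?P)"
    unfolding interaction_def p_def by (subst nn_integral_add) (auto simp: case_prod_unfold)
  also have "\<dots> = (\<integral>\<^sup>+x. ennreal (ln 2) + e2ennreal (max 0 (- e (fst x) (snd x))) \<partial>?P)"
    unfolding e_def log_kernel_add_elog ..
  also have "\<dots> = ennreal (ln 2) + n"
    unfolding n_def by (subst nn_integral_add) (auto simp: P.emeasure_space_1)
  finally have sum: "interaction M Y + p = ennreal (ln 2) + n" .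
  \<comment> \<open>Chords have length at most 2, so the positive part is integrable, and the finite
    \<open>p\<close> can be cancelled from \<open>sum\<close>.\<close>
  have "p \<le> (\<integral>\<^sup>+x. ennreal (ln 2) \<partial>?P)"
    unfolding p_def
  proof (intro nn_integral_mono)
    fix x
    show "e2ennreal (max 0 (e (fst x) (snd x))) \<le> ennreal (ln 2)"
      unfolding e_def by (intro e2ennreal_elog_chord_le)
  qed
  also have "\<dots> < top"
    by (simp add: P.emeasure_space_1)
  finally obtain p' where p': "p = ennreal p'" "p' \<ge> 0"
    by (cases p) auto
  have I: "enn2ereal (interaction M Y) = ereal (ln 2) + enn2ereal n - enn2ereal p"
  proof -
    have "enn2ereal (interaction M Y) + enn2ereal p = ereal (ln 2) + enn2ereal n"
      using arg_cong[OF sum, of enn2ereal] by (simp add: plus_ennreal.rep_eq)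
    then show ?thesis
      using p' by (cases "enn2ereal (interaction M Y)"; cases "enn2ereal n") auto
  qed
  have "(\<integral>z. Q z \<partial>?N) = (\<integral>s. Q (cis (Y s)) \<partial>M)"
    unfolding arc_law_def using borel_measurable_on_circle[OF Q] by (intro integral_distr) auto
  then show ?thesis
    unfolding energy_def eint I using p' by (cases "enn2ereal n") auto
qed

section \<open>Displacement convexity\<close>

lemma bounded_on_circle:
  assumes "continuous_on UNIV (\<lambda>x. Q (cis x) :: real)"
  obtains B where "\<And>x. \<bar>Q (cis x)\<bar> \<le> B"
proof -
  have "compact ((\<lambda>x. Q (cis x)) ` {-pi..pi})"
    by (intro compact_continuous_image continuous_on_subset[OF assms]) auto
  then obtain B where B: "\<forall>x\<in>{-pi..pi}. \<bar>Q (cis x)\<bar> \<le> B"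
    by (auto dest!: compact_imp_bounded simp: bounded_iff)
  have "\<bar>Q (cis x)\<bar> \<le> B" for x
    using B[rule_format, of "Arg (cis x)"] Arg_bounded[of "cis x"] by (simp add: cis_Arg_unit)
  then show ?thesis by (rule that)
qed

text \<open>By \<open>order\<close> both increments lie in [0, 2 pi] with a common orientation, so
  the strong convexity of the kernel applies to each pair. Evenness of the kernel handles the
  reversed orientation.\<close>

lemma interaction_interpolation:
  fixes M :: "'a measure" and X Y :: "'a \<Rightarrow> real"
  assumes [measurable]: "X \<in> borel_measurable M" "Y \<in> borel_measurable M"
    and order: "\<And>s s'. s \<in> space M \<Longrightarrow> s' \<in> space M \<Longrightarrow>
      (X s - X s' \<in> {0..2 * pi} \<and> Y s - Y s' \<in> {0..2 * pi}) \<or>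
      (X s' - X s \<in> {0..2 * pi} \<and> Y s' - Y s \<in> {0..2 * pi})"
    and t: "0 < t" "t < 1"
  shows "interaction M (\<lambda>s. (1 - t) * X s + t * Y s)
      + (\<integral>\<^sup>+(s, s'). ennreal (t * (1 - t) / 8 * ((X s - Y s) - (X s' - Y s'))\<^sup>2) \<partial>(M \<Otimes>\<^sub>M M))
     \<le> ennreal (1 - t) * interaction M X + ennreal t * interaction M Y"
proof -
  let ?P = "M \<Otimes>\<^sub>M M"
  have pointwise: "log_kernel (((1 - t) * X s + t * Y s) - ((1 - t) * X s' + t * Y s'))
      + ennreal (t * (1 - t) / 8 * ((X s - Y s) - (X s' - Y s'))\<^sup>2)
      \<le> ennreal (1 - t) * log_kernel (X s - X s') + ennreal t * log_kernel (Y s - Y s')"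
    if "s \<in> space M" "s' \<in> space M" for s s'
    using order[OF that]
  proof
    have e: "((1 - t) * X s + t * Y s) - ((1 - t) * X s' + t * Y s') = (1 - t) * (X s - X s') + t * (Y s - Y s')"
      "t * (1 - t) / 8 * ((X s - Y s) - (X s' - Y s'))\<^sup>2 = t * (1 - t) * ((X s - X s') - (Y s - Y s'))\<^sup>2 / 8"
      by (simp_all add: algebra_simps)
    assume "X s - X s' \<in> {0..2 * pi} \<and> Y s - Y s' \<in> {0..2 * pi}"
    then show ?thesis
      unfolding e by (intro log_kernel_strongly_convex t) auto
  next
    have sq: "((X s - Y s) - (X s' - Y s'))\<^sup>2 = ((X s' - X s) - (Y s' - Y s))\<^sup>2"
      by (simp add: power2_eq_square algebra_simps)
    have e: "((1 - t) * X s + t * Y s) - ((1 - t) * X s' + t * Y s') = - ((1 - t) * (X s' - X s) + t * (Y s' - Y s))"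
      "t * (1 - t) / 8 * ((X s - Y s) - (X s' - Y s'))\<^sup>2 = t * (1 - t) * ((X s' - X s) - (Y s' - Y s))\<^sup>2 / 8"
      "log_kernel (X s - X s') = log_kernel (X s' - X s)" "log_kernel (Y s - Y s') = log_kernel (Y s' - Y s)"
      using log_kernel_minus[of "X s - X s'"] log_kernel_minus[of "Y s - Y s'"]
      by (simp_all add: sq) (simp add: algebra_simps)
    assume "X s' - X s \<in> {0..2 * pi} \<and> Y s' - Y s \<in> {0..2 * pi}"
    then show ?thesis
      unfolding e log_kernel_minus by (intro log_kernel_strongly_convex t) auto
  qed
  have "interaction M (\<lambda>s. (1 - t) * X s + t * Y s)
      + (\<integral>\<^sup>+(s, s'). ennreal (t * (1 - t) / 8 * ((X s - Y s) - (X s' - Y s'))\<^sup>2) \<partial>?P)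
    = (\<integral>\<^sup>+(s, s'). log_kernel (((1 - t) * X s + t * Y s) - ((1 - t) * X s' + t * Y s'))
      + ennreal (t * (1 - t) / 8 * ((X s - Y s) - (X s' - Y s'))\<^sup>2) \<partial>?P)"
    unfolding interaction_def case_prod_unfold by (intro nn_integral_add[symmetric]) measurable
  also have "\<dots> \<le> (\<integral>\<^sup>+(s, s'). ennreal (1 - t) * log_kernel (X s - X s') + ennreal t * log_kernel (Y s - Y s') \<partial>?P)"
    unfolding case_prod_unfold by (intro nn_integral_mono pointwise) (auto simp: space_pair_measure)
  also have "\<dots> = ennreal (1 - t) * interaction M X + ennreal t * interaction M Y"
    unfolding interaction_def case_prod_unfold
    by (subst nn_integral_add) (auto simp: nn_integral_cmult)
  finally show ?thesis .
qed

lemma (in prob_space) integrable_square_bounded: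
  fixes D :: "'a \<Rightarrow> real"
  assumes [measurable]: "D \<in> borel_measurable M" and bounded: "\<And>s. s \<in> space M \<Longrightarrow> \<bar>D s\<bar> \<le> C"
  shows "integrable M (\<lambda>s. (D s)\<^sup>2)"
proof (rule integrable_const_bound[of _ "C\<^sup>2"])
  have "(D s)\<^sup>2 \<le> C\<^sup>2" if "s \<in> space M" for s
    using power_mono[OF bounded[OF that], of 2] by simp
  then show "AE s in M. norm ((D s)\<^sup>2) \<le> C\<^sup>2" by (auto intro!: AE_I2)
qed measurable

text \<open>After expanding the square, the cross term vanishes because \<open>D\<close> has mean
  zero, leaving twice the second moment. This is how the kernel's 1/8 becomes 1/4.\<close>

lemma (in prob_space) nn_integral_square_diff_centered:
  fixes D :: "'a \<Rightarrow> real"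
  assumes [measurable]: "D \<in> borel_measurable M"
    and bounded: "\<And>s. s \<in> space M \<Longrightarrow> \<bar>D s\<bar> \<le> C"
    and mean: "expectation D = 0" and c: "c \<ge> 0"
  shows "(\<integral>\<^sup>+(s, s'). ennreal (c * (D s - D s')\<^sup>2) \<partial>(M \<Otimes>\<^sub>M M))
    = ennreal (2 * c * expectation (\<lambda>s. (D s)\<^sup>2))"
proof -
  define v where "v = expectation (\<lambda>s. (D s)\<^sup>2)"
  have iD: "integrable M D"
    by (rule integrable_const_bound[of _ C]) (use bounded in auto)
  have iD2: "integrable M (\<lambda>s. (D s)\<^sup>2)"
    by (rule integrable_square_bounded[OF _ bounded]) auto
  have v: "v \<ge> 0" unfolding v_def by simp
  have inner: "(\<integral>\<^sup>+s'. ennreal (c * (D s - D s')\<^sup>2) \<partial>M) = ennreal (c * (D s)\<^sup>2 + c * v)" for s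
  proof -
    have e: "c * (D s - D s')\<^sup>2 = c * (D s)\<^sup>2 - 2 * c * D s * D s' + c * (D s')\<^sup>2" for s'
      by (simp add: power2_eq_square algebra_simps)
    have "(\<integral>\<^sup>+s'. ennreal (c * (D s - D s')\<^sup>2) \<partial>M) = ennreal (\<integral>s'. c * (D s - D s')\<^sup>2 \<partial>M)"
    proof (rule nn_integral_eq_integral)
      show "integrable M (\<lambda>s'. c * (D s - D s')\<^sup>2)"
        unfolding e using iD iD2 by auto
      show "AE s' in M. 0 \<le> c * (D s - D s')\<^sup>2"
        using c by simp
    qed
    also have "(\<integral>s'. c * (D s - D s')\<^sup>2 \<partial>M) = c * (D s)\<^sup>2 + c * v"
      unfolding e v_def using iD iD2 by (simp add: mean prob_space)
    finally show ?thesis .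
  qed
  have "(\<integral>\<^sup>+(s, s'). ennreal (c * (D s - D s')\<^sup>2) \<partial>(M \<Otimes>\<^sub>M M))
      = (\<integral>\<^sup>+s. \<integral>\<^sup>+s'. ennreal (c * (D s - D s')\<^sup>2) \<partial>M \<partial>M)"
    by (subst nn_integral_fst[symmetric]) (auto simp: case_prod_unfold)
  also have "\<dots> = ennreal (\<integral>s. c * (D s)\<^sup>2 + c * v \<partial>M)"
    unfolding inner using c v iD2 by (intro nn_integral_eq_integral) auto
  also have "(\<integral>s. c * (D s)\<^sup>2 + c * v \<partial>M) = 2 * c * v"
    using iD2 by (simp add: prob_space v_def[symmetric])
  finally show ?thesis unfolding v_def .
qed

text \<open>The potential is gained pointwise in s, the interaction over pairs. Centering turns the
  latter into a multiple of the same second moment, so the constants \<rho> and 1/4 add.\<close>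

lemma (in prob_space) energy_displacement_convex:
  fixes X Y :: "'a \<Rightarrow> real"
  assumes [measurable]: "X \<in> borel_measurable M" "Y \<in> borel_measurable M"
    and bounded: "\<And>s. s \<in> space M \<Longrightarrow> \<bar>X s\<bar> \<le> C" "\<And>s. s \<in> space M \<Longrightarrow> \<bar>Y s\<bar> \<le> C"
    and order: "\<And>s s'. s \<in> space M \<Longrightarrow> s' \<in> space M \<Longrightarrow>
      (X s - X s' \<in> {0..2 * pi} \<and> Y s - Y s' \<in> {0..2 * pi}) \<or>
      (X s' - X s \<in> {0..2 * pi} \<and> Y s' - Y s \<in> {0..2 * pi})"
    and mean: "expectation (\<lambda>s. X s - Y s) = 0"
    and conv: "convex_on UNIV (\<lambda>x. Q (cis x) - \<rho> * x\<^sup>2)"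
    and Q: "continuous_on UNIV (\<lambda>x. Q (cis x))"
    and t: "0 < t" "t < 1"
    and fin: "energy Q (arc_law M X) = ereal a" "energy Q (arc_law M Y) = ereal b"
  shows "energy Q (arc_law M (\<lambda>s. (1 - t) * X s + t * Y s))
    \<le> ereal ((1 - t) * a + t * b - (\<rho> + 1 / 4) * (t * (1 - t) * expectation (\<lambda>s. (X s - Y s)\<^sup>2)))"
proof -
  define Z where "Z s = (1 - t) * X s + t * Y s" for s
  define v where "v = expectation (\<lambda>s. (X s - Y s)\<^sup>2)"
  have [measurable]: "Z \<in> borel_measurable M" unfolding Z_def by measurable
  have v: "v \<ge> 0" unfolding v_def by simp
  have bD: "\<bar>X s - Y s\<bar> \<le> 2 * C" if "s \<in> space M" for s
    using bounded[OF that] by linarith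
  have iD2: "integrable M (\<lambda>s. (X s - Y s)\<^sup>2)"
    by (rule integrable_square_bounded[OF _ bD]) auto
  obtain B where B: "\<And>x. \<bar>Q (cis x)\<bar> \<le> B" using bounded_on_circle[OF Q] by blast
  have iQ: "integrable M (\<lambda>s. Q (cis (W s)))" if [measurable]: "W \<in> borel_measurable M" for W
    by (rule integrable_const_bound[of _ B])
       (use B in \<open>auto intro!: measurable_compose[OF that borel_measurable_continuous_onI[OF Q]]\<close>)
  have Qpt: "Q (cis (Z s)) \<le> (1 - t) * Q (cis (X s)) + t * Q (cis (Y s)) - \<rho> * (t * (1 - t)) * (X s - Y s)\<^sup>2" for s
  proof -
    have "Q (cis (Z s)) - \<rho> * (Z s)\<^sup>2 \<le> (1 - t) * (Q (cis (X s)) - \<rho> * (X s)\<^sup>2) + t * (Q (cis (Y s)) - \<rho> * (Y s)\<^sup>2)"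
      using convex_onD[OF conv, of t "X s" "Y s"] t by (simp add: Z_def)
    also have "\<dots> = (1 - t) * Q (cis (X s)) + t * Q (cis (Y s)) - \<rho> * ((1 - t) * (X s)\<^sup>2 + t * (Y s)\<^sup>2)"
      by (simp add: algebra_simps)
    finally show ?thesis
      unfolding convex_square_defect Z_def[symmetric] by (simp add: algebra_simps)
  qed
  let ?q = "\<lambda>W. \<integral>s. Q (cis (W s)) \<partial>M"
  have "?q Z \<le> (\<integral>s. (1 - t) * Q (cis (X s)) + t * Q (cis (Y s)) - \<rho> * (t * (1 - t)) * (X s - Y s)\<^sup>2 \<partial>M)"
    by (intro integral_mono Qpt Bochner_Integration.integrable_diff Bochner_Integration.integrable_add
        integrable_mult_right iQ iD2) auto
  also have "\<dots> = (1 - t) * ?q X + t * ?q Y - \<rho> * (t * (1 - t)) * v"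
    using iD2 iQ[of X] iQ[of Y] by (simp add: v_def)
  finally have q: "?q Z \<le> (1 - t) * ?q X + t * ?q Y - \<rho> * (t * (1 - t)) * v" .
  \<comment> \<open>Finite energy forces finite interaction, so the \<open>ennreal\<close> estimate
    can be read among real numbers.\<close>
  have fin_int: "\<exists>k\<ge>0. interaction M W = ennreal k \<and> e = ?q W - ln 2 + k"
    if "W \<in> borel_measurable M" "energy Q (arc_law M W) = ereal e" for W e
    using that(2) unfolding energy_arc_law[OF that(1) Q]
    by (cases "interaction M W") auto
  obtain kX kY where k: "kX \<ge> 0" "kY \<ge> 0" "interaction M X = ennreal kX" "interaction M Y = ennreal kY"
      "a = ?q X - ln 2 + kX" "b = ?q Y - ln 2 + kY"
    using fin_int[OF _ fin(1)] fin_int[OF _ fin(2)] by auto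
  have "interaction M Z + ennreal (t * (1 - t) / 4 * v) \<le> ennreal ((1 - t) * kX + t * kY)"
  proof -
    have "ennreal (t * (1 - t) / 4 * v)
        = (\<integral>\<^sup>+(s, s'). ennreal (t * (1 - t) / 8 * ((X s - Y s) - (X s' - Y s'))\<^sup>2) \<partial>(M \<Otimes>\<^sub>M M))"
      using nn_integral_square_diff_centered[OF _ bD mean, of "t * (1 - t) / 8"] t by (simp add: v_def)
    then have "interaction M Z + ennreal (t * (1 - t) / 4 * v) \<le> ennreal (1 - t) * ennreal kX + ennreal t * ennreal kY"
      using interaction_interpolation[of X M Y, OF _ _ order t] k unfolding Z_def[abs_def] by simp
    also have "\<dots> = ennreal ((1 - t) * kX + t * kY)"
      using t k by (simp add: ennreal_plus ennreal_mult)
    finally show ?thesis .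
  qed
  then obtain kZ where kZ: "kZ \<ge> 0" "interaction M Z = ennreal kZ" "kZ + t * (1 - t) / 4 * v \<le> (1 - t) * kX + t * kY"
    using t k v by (cases "interaction M Z") (auto simp: top_unique simp flip: ennreal_plus)
  have "energy Q (arc_law M Z) = ereal (?q Z - ln 2 + kZ)"
    using kZ by (simp add: energy_arc_law[OF _ Q])
  also have "\<dots> \<le> ereal ((1 - t) * a + t * b - (\<rho> + 1 / 4) * (t * (1 - t) * v))"
    using q kZ(3) unfolding k by (simp add: field_simps)
  finally show ?thesis unfolding Z_def[abs_def] v_def .
qed

text \<open>Minimality bounds the interpolated energy below by \<open>a\<close>. Subtracting
  \<open>a\<close> from the convexity estimate and dividing by t leaves a factor 1 - t, which tends
  to 1.\<close>

lemma (in prob_space) energy_minimizer_gap: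
  fixes X Y :: "'a \<Rightarrow> real"
  assumes [measurable]: "X \<in> borel_measurable M" "Y \<in> borel_measurable M"
    and bounded: "\<And>s. s \<in> space M \<Longrightarrow> \<bar>X s\<bar> \<le> C" "\<And>s. s \<in> space M \<Longrightarrow> \<bar>Y s\<bar> \<le> C"
    and order: "\<And>s s'. s \<in> space M \<Longrightarrow> s' \<in> space M \<Longrightarrow>
      (X s - X s' \<in> {0..2 * pi} \<and> Y s - Y s' \<in> {0..2 * pi}) \<or>
      (X s' - X s \<in> {0..2 * pi} \<and> Y s' - Y s \<in> {0..2 * pi})"
    and mean: "expectation (\<lambda>s. X s - Y s) = 0"
    and conv: "convex_on UNIV (\<lambda>x. Q (cis x) - \<rho> * x\<^sup>2)"
    and Q: "continuous_on UNIV (\<lambda>x. Q (cis x))"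
    and fin: "energy Q (arc_law M X) = ereal a" "energy Q (arc_law M Y) = ereal b"
    and min: "energy Q (arc_law M X) = min_energy Q"
  shows "(\<rho> + 1 / 4) * expectation (\<lambda>s. (X s - Y s)\<^sup>2) \<le> b - a"
proof -
  let ?d = "(\<rho> + 1 / 4) * expectation (\<lambda>s. (X s - Y s)\<^sup>2)"
  have ineq: "(1 - t) * ?d \<le> b - a" if t: "t \<in> {0<..<1}" for t
  proof -
    have "ereal a \<le> energy Q (arc_law M (\<lambda>s. (1 - t) * X s + t * Y s))"
      unfolding fin(1)[symmetric] min min_energy_def
      by (intro INF_lower arc_law_in_borel_prob_measures prob_space_axioms) measurable
    also have "\<dots> \<le> ereal ((1 - t) * a + t * b - (\<rho> + 1 / 4) * (t * (1 - t) * expectation (\<lambda>s. (X s - Y s)\<^sup>2)))"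
      using t by (intro energy_displacement_convex[OF assms(1,2) bounded order mean conv Q _ _ fin]) auto
    finally have "t * ((1 - t) * ?d) \<le> t * (b - a)"
      by (simp add: field_simps)
    then show ?thesis
      using t by simp
  qed
  have "((\<lambda>t. (1 - t) * ?d) \<longlongrightarrow> (1 - 0) * ?d) (at_right 0)"
    by (intro tendsto_intros)
  moreover have "\<forall>\<^sub>F t in at_right 0. (1 - t) * ?d \<le> b - a"
    using eventually_at_right_real[of 0 1] by (auto elim!: eventually_mono intro!: ineq)
  ultimately show ?thesis
    using tendsto_upperbound[of "\<lambda>t. (1 - t) * ?d" "(1 - 0) * ?d" "at_right 0" "b - a"] by simp
qed

section \<open>Monotone lifts\<close>

abbreviation unit_uniform :: "real measure"
  where "unit_uniform \<equiv> restrict_space lborel {0<..<1}"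

lemma prob_space_unit_uniform: "prob_space unit_uniform"
  by (rule prob_spaceI) (simp add: space_restrict_space emeasure_restrict_space)

lemma space_unit_uniform: "space unit_uniform = {0<..<1}"
  by (simp add: space_restrict_space)

lemma nn_integral_unit_uniform:
  "(\<integral>\<^sup>+s. f s \<partial>unit_uniform) = (\<integral>\<^sup>+s. f s * indicator {0<..<1} s \<partial>lborel)"
  by (simp add: nn_integral_restrict_space)

text \<open>Periodicity reduces the shift to its fractional part t. The interval (t, 1 + t) is then
  cut at 1 and the right piece moved back by one period.\<close>

lemma nn_integral_periodic_shift:
  fixes h :: "real \<Rightarrow> ennreal"
  assumes [measurable]: "h \<in> borel_measurable borel" and per: "\<And>s. h (s + 1) = h s"
  shows "(\<integral>\<^sup>+s. h (s + \<theta>) \<partial>unit_uniform) = (\<integral>\<^sup>+s. h s \<partial>unit_uniform)"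
proof -
  have per_nat: "h (s + real n) = h s" for s n
  proof (induction n)
    case (Suc n)
    then show ?case using per[of "s + real n"] by (simp add: ac_simps)
  qed simp
  have per_int: "h (s + of_int k) = h s" for s k
  proof (cases "k \<ge> 0")
    case True
    then show ?thesis using per_nat[of s "nat k"] by simp
  next
    case False
    then show ?thesis using per_nat[of "s + of_int k" "nat (- k)"] by simp
  qed
  define t where "t = frac \<theta>"
  have t: "0 \<le> t" "t < 1" by (auto simp: t_def frac_lt_1)
  have "h (s + \<theta>) = h (s + t)" for s
    using per_int[of "s + t" "\<lfloor>\<theta>\<rfloor>"] by (simp add: t_def frac_def)
  then have "(\<integral>\<^sup>+s. h (s + \<theta>) \<partial>unit_uniform) = (\<integral>\<^sup>+s. h (t + 1 * s) * indicator {t<..<1 + t} (t + 1 * s) \<partial>lborel)"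
    unfolding nn_integral_unit_uniform by (auto intro!: nn_integral_cong simp: indicator_def add.commute)
  also have "\<dots> = (\<integral>\<^sup>+u. h u * indicator {t<..<1 + t} u \<partial>lborel)"
    by (subst (2) nn_integral_real_affine[where c = 1 and t = t]) auto
  also have "\<dots> = (\<integral>\<^sup>+u. h u * indicator {t<..<1} u + h u * indicator {1..<1 + t} u \<partial>lborel)"
    using t by (intro nn_integral_cong) (auto simp: indicator_def)
  also have "\<dots> = (\<integral>\<^sup>+u. h u * indicator {t<..<1} u \<partial>lborel) + (\<integral>\<^sup>+u. h u * indicator {1..<1 + t} u \<partial>lborel)"
    by (intro nn_integral_add) auto
  also have "(\<integral>\<^sup>+u. h u * indicator {1..<1 + t} u \<partial>lborel) = (\<integral>\<^sup>+u. h (1 + 1 * u) * indicator {1..<1 + t} (1 + 1 * u) \<partial>lborel)"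
    by (subst nn_integral_real_affine[where c = 1 and t = 1]) auto
  also have "\<dots> = (\<integral>\<^sup>+u. h u * indicator {0..<t} u \<partial>lborel)"
    using per by (intro nn_integral_cong) (auto simp: indicator_def add.commute)
  also have "(\<integral>\<^sup>+u. h u * indicator {t<..<1} u \<partial>lborel) + \<dots>
      = (\<integral>\<^sup>+u. h u * indicator {t<..<1} u + h u * indicator {0..<t} u \<partial>lborel)"
    by (intro nn_integral_add[symmetric]) auto
  also have "\<dots> = (\<integral>\<^sup>+u. h u * indicator {0<..<1} u \<partial>lborel)"
  proof (rule nn_integral_cong_AE)
    \<comment> \<open>The reassembled pieces can differ from (0, 1) only at t and at 0, which are
      null.\<close>
    have "AE u in lborel. u \<noteq> t" "AE u in lborel. u \<noteq> (0::real)"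
      by (rule AE_lborel_singleton)+
    then show "AE u in lborel. h u * indicator {t<..<1} u + h u * indicator {0..<t} u = h u * indicator {0<..<1} u"
      by eventually_elim (use t in \<open>auto simp: indicator_def\<close>)
  qed
  finally show ?thesis unfolding nn_integral_unit_uniform .
qed

lemma distr_periodic_shift:
  assumes [measurable]: "P \<in> measurable borel N" and per: "\<And>s :: real. P (s + 1) = P s"
  shows "distr unit_uniform N (\<lambda>s. P (s + \<theta>)) = distr unit_uniform N P"
proof (rule measure_eqI)
  fix A assume "A \<in> sets (distr unit_uniform N (\<lambda>s. P (s + \<theta>)))"
  then have [measurable]: "A \<in> sets N" by simp
  have [measurable]: "P \<in> measurable unit_uniform N" "(\<lambda>s. P (s + \<theta>)) \<in> measurable unit_uniform N"
    by (rule measurable_restrict_space1, measurable)+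
  have "emeasure (distr unit_uniform N (\<lambda>s. P (s + \<theta>))) A = (\<integral>\<^sup>+s. indicator A (P (s + \<theta>)) \<partial>unit_uniform)"
    by (subst nn_integral_indicator[symmetric], simp, subst nn_integral_distr) auto
  also have "\<dots> = (\<integral>\<^sup>+s. indicator A (P s) \<partial>unit_uniform)"
    by (rule nn_integral_periodic_shift[where h = "\<lambda>s. indicator A (P s)"]) (auto simp: per)
  also have "\<dots> = emeasure (distr unit_uniform N P) A"
    by (subst nn_integral_indicator[symmetric], simp, subst nn_integral_distr) auto
  finally show "emeasure (distr unit_uniform N (\<lambda>s. P (s + \<theta>))) A = emeasure (distr unit_uniform N P) A" .
qed simp

text \<open>Monotone lifts to the line of degree one maps \<open>\<real> / \<int> \<rightarrow> \<real> / 2 \<pi> \<int>\<close>.\<close>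
definition circle_lift :: "(real \<Rightarrow> real) \<Rightarrow> bool"
  where "circle_lift G \<longleftrightarrow> mono G \<and> (\<forall>s. G (s + 1) = G s + 2 * pi)"

lemma circle_lift_measurable: "circle_lift G \<Longrightarrow> G \<in> borel_measurable borel"
  by (simp add: circle_lift_def borel_measurable_mono)

lemma circle_lift_shift: "circle_lift G \<Longrightarrow> circle_lift (\<lambda>s. G (s + \<theta>))"
  unfolding circle_lift_def
proof (intro conjI allI monoI; elim conjE)
  fix x y :: real assume "mono G" "x \<le> y"
  then show "G (x + \<theta>) \<le> G (y + \<theta>)" by (auto intro: monoD)
next
  fix s assume "\<forall>s. G (s + 1) = G s + 2 * pi"
  then have "G ((s + \<theta>) + 1) = G (s + \<theta>) + 2 * pi" by blast
  then show "G (s + 1 + \<theta>) = G (s + \<theta>) + 2 * pi" by (simp add: ac_simps)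
qed

text \<open>The increment over a full period is 2 pi, and monotonicity caps every shorter increment
  by it. This yields the \<open>order\<close> hypothesis of the convexity estimates.\<close>

lemma circle_lift_diff:
  assumes "circle_lift G" "s' \<le> s" "s \<le> s' + 1"
  shows "G s - G s' \<in> {0..2 * pi}"
proof -
  have "mono G" "G (s' + 1) = G s' + 2 * pi"
    using assms(1) by (auto simp: circle_lift_def)
  then show ?thesis
    using assms(2,3) monoD[of G s' s] monoD[of G s "s' + 1"] by simp
qed

lemma circle_lift_bounded:
  assumes "circle_lift G"
  obtains C where "\<And>s. s \<in> {0<..<1} \<Longrightarrow> \<bar>G s\<bar> \<le> C"
proof (rule that)
  fix s :: real assume "s \<in> {0<..<1}"
  then show "\<bar>G s\<bar> \<le> \<bar>G 0\<bar> + 2 * pi"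
    using circle_lift_diff[OF assms, of 0 s] by auto
qed

text \<open>The angle law \<open>\<mu>\<close> lives on (-pi, pi]. Its quantile function
  \<open>I\<close> transports the uniform law to \<open>\<mu>\<close>, and adding 2 pi for each unit
  step extends it to a lift.\<close>

lemma ex_circle_lift:
  assumes N: "N \<in> borel_prob_measures circle"
  obtains G where "circle_lift G" "arc_law unit_uniform G = N"
proof -
  have pN: "prob_space N" and sN: "sets N = sets circle_borel"
    using N by (auto simp: borel_prob_measures_def)
  have spN: "space N = circle"
    using sets_eq_imp_space_eq[OF sN] by (simp add: space_restrict_space)
  interpret N: prob_space N by fact
  have [measurable]: "Arg \<in> borel_measurable N"
    using measurable_restrict_space1[OF Arg_measurable] by (subst measurable_cong_sets[OF sN refl])
  define \<mu> where "\<mu> = distr N borel Arg"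
  interpret cdf_distribution \<mu>
    unfolding cdf_distribution_def \<mu>_def by (rule N.real_distribution_distr) simp
  have Ctop: "C pi = 1"
  proof -
    have "C pi = measure N (space N)"
      unfolding cdf_def \<mu>_def by (subst measure_distr) (auto intro!: arg_cong[where f = "measure N"] Arg_le_pi)
    then show ?thesis by (simp add: N.prob_space)
  qed
  have Cbot: "C x = 0" if "x \<le> - pi" for x
  proof -
    have "\<not> Arg z \<le> x" for z
      using mpi_less_Arg[of z] that by linarith
    then have "Arg -` {..x} \<inter> space N = {}"
      by auto
    then show ?thesis
      unfolding cdf_def \<mu>_def by (subst measure_distr) auto
  qed
  \<comment> \<open>By \<open>pseudoinverse\<close>, \<open>I s \<le> x\<close> holds iff
    \<open>s \<le> C x\<close>; the two bounds come from \<open>C pi = 1\<close> and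
    \<open>C (- pi) = 0\<close>.\<close>
  have I: "I s \<in> {-pi..pi}" if s: "s \<in> {0<..<1}" for s
  proof -
    have "I s \<le> pi" using pseudoinverse[of s pi] s Ctop by simp
    moreover have "\<not> I s \<le> - pi" using pseudoinverse[of s "- pi"] s Cbot by simp
    ultimately show ?thesis by simp
  qed
  \<comment> \<open>The quantile function is controlled only on the open unit interval, so integers
    receive the lower end -pi of its range, which preserves monotonicity.\<close>
  define G where "G s = (if frac s = 0 then - pi else I (frac s)) + 2 * pi * of_int \<lfloor>s\<rfloor>" for s
  have G1: "(if frac s = 0 then - pi else I (frac s)) \<in> {- pi..pi}" for s
    using I[of "frac s"] frac_ge_0[of s] frac_lt_1[of s] by auto
  have "circle_lift G"
    unfolding circle_lift_def
  proof (intro conjI allI monoI)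
    fix s :: real
    have "frac (s + 1) = frac s" by (rule frac_1_eq)
    then show "G (s + 1) = G s + 2 * pi"
      unfolding G_def by (simp add: distrib_left)
  next
    fix x y :: real assume xy: "x \<le> y"
    consider "\<lfloor>x\<rfloor> = \<lfloor>y\<rfloor>" | "\<lfloor>x\<rfloor> + 1 \<le> \<lfloor>y\<rfloor>"
      using floor_mono[OF xy] by linarith
    then show "G x \<le> G y"
    proof cases
      case 1
      then have f: "frac x \<le> frac y" using xy by (simp add: frac_def)
      have "(if frac x = 0 then - pi else I (frac x)) \<le> (if frac y = 0 then - pi else I (frac y))"
      proof (cases "frac x = 0")
        case True
        then show ?thesis using G1[of y] by simp
      next
        case False
        then have "frac x \<in> {0<..<1}" "frac y \<in> {0<..<1}"
          using f frac_ge_0[of x] frac_lt_1[of x] frac_lt_1[of y]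
          unfolding greaterThanLessThan_iff by linarith+
        then have "I (frac x) \<le> I (frac y)"
          using mono_I f by (auto simp: mono_on_def)
        moreover have "frac y \<noteq> 0" using \<open>frac y \<in> {0<..<1}\<close> by auto
        ultimately show ?thesis using False by (simp only: if_False)
      qed
      then show ?thesis by (simp add: G_def 1)
    next
      \<comment> \<open>The base values lie in an interval of length 2 pi, so the jump of 2 pi to a
        later cell outweighs any decrease.\<close>
      case 2
      then have "real_of_int \<lfloor>x\<rfloor> + 1 \<le> of_int \<lfloor>y\<rfloor>" by linarith
      then have "2 * pi * (of_int \<lfloor>x\<rfloor> + 1) \<le> 2 * pi * of_int \<lfloor>y\<rfloor>"
        by (intro mult_left_mono) auto
      then show ?thesis
        using G1[of x] G1[of y] unfolding G_def atLeastAtMost_iff distrib_left mult_1_right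
        by linarith
    qed
  qed
  have measurable_I: "I \<in> borel_measurable unit_uniform"
    using measurable_CI by (subst measurable_cong_sets[of _ "restrict_space borel {0<..<1}" borel borel])
      (auto simp: sets_restrict_space)
  have "arc_law unit_uniform G = distr unit_uniform circle_borel (\<lambda>s. cis (I s))"
    unfolding arc_law_def
  proof (intro distr_cong refl)
    fix s assume "s \<in> space unit_uniform"
    then have "s \<in> {0<..<1}" by (simp add: space_unit_uniform)
    then have f: "frac s = s" "\<lfloor>s\<rfloor> = 0" "s \<noteq> 0" by (simp_all add: frac_eq floor_eq_iff)
    show "cis (G s) = cis (I s)"
      unfolding G_def f(1,2) using f(3) by (simp only: if_False of_int_0 mult_zero_right add_0_right)
  qed
  also have "\<dots> = distr (distr unit_uniform borel I) circle_borel cis"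
    by (subst distr_distr[OF _ measurable_I]) (auto simp: comp_def)
  also have "\<dots> = distr \<mu> circle_borel cis"
    by (simp only: distr_I_eq_M)
  also have "\<dots> = distr N circle_borel (\<lambda>z. cis (Arg z))"
    unfolding \<mu>_def by (subst distr_distr) (auto simp: comp_def)
  also have "\<dots> = distr N circle_borel (\<lambda>z. z)"
    by (intro distr_cong refl cis_Arg_unit) (simp add: spN)
  also have "\<dots> = N" by (rule distr_id2[OF sN[symmetric]])
  finally show ?thesis using \<open>circle_lift G\<close> that by blast
qed

section \<open>Existence of a minimizer\<close>

lemma sin_ge_half: "x / 2 \<le> sin x" if "0 \<le> x" "x \<le> 1 / 2" for x :: real
proof (cases "x = 0")
  case False
  with that have "0 < x" by simp
  then have "\<exists>z. 0 < z \<and> z < x \<and> sin x - sin 0 = (x - 0) * cos z"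
    by (rule MVT2) (rule DERIV_sin)
  then obtain z where z: "0 < z" "z < x" "sin x - sin 0 = (x - 0) * cos z"
    by blast
  \<comment> \<open>As 1/2 < pi / 3, the derivative of the sine stays above 1/2 on the whole
    range.\<close>
  have "cos (pi / 3) \<le> cos z"
    using z that pi_gt3 by (intro cos_monotone_0_pi_le) auto
  then have "1 / 2 \<le> cos z" by (simp add: cos_60)
  then show ?thesis
    using z that mult_left_mono[of "1 / 2" "cos z" x] by simp
qed simp

text \<open>With w = \<bar>v\<bar>, sin (w / 2) \<ge> w / 4 and - ln (w / 4) = 2 ln (2 / sqrt w)
  \<le> 4 / sqrt w. The logarithm is traded for an integrable power with an explicit
  primitive.\<close>

lemma log_kernel_le_inverse_sqrt:
  assumes "0 < \<bar>v\<bar>" "\<bar>v\<bar> \<le> 1"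
  shows "log_kernel v \<le> ennreal (4 / \<bar>sqrt v\<bar>)"
proof -
  define w where "w = \<bar>v\<bar>"
  have w: "0 < w" "w \<le> 1" using assms by (auto simp: w_def)
  have s: "w / 4 \<le> sin (w / 2)" using sin_ge_half[of "w / 2"] w by simp
  then have pos: "sin (w / 2) > 0" using w by linarith
  have "- ln (sin (w / 2)) \<le> - ln (w / 4)"
    using s w pos by simp
  also have "w / 4 = inverse ((2 / sqrt w)\<^sup>2)"
    using w by (simp add: power_divide)
  also have "- ln \<dots> = 2 * ln (2 / sqrt w)"
    using w by (subst ln_inverse, simp, subst ln_realpow) auto
  also have "\<dots> \<le> 2 * (2 / sqrt w)"
    using w ln_le_minus_one[of "2 / sqrt w"] by simp
  finally have "log_kernel w \<le> ennreal (4 / sqrt w)"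
    using pos by (simp add: log_kernel_def ennreal_leI)
  then show ?thesis
    by (simp add: w_def log_kernel_abs real_sqrt_abs')
qed

lemma integral_inverse_sqrt_finite:
  "(\<integral>\<^sup>+v. ennreal (4 / \<bar>sqrt v\<bar>) * indicator {-1..1} v \<partial>lborel) = 16"
proof -
  \<comment> \<open>The library's \<open>sqrt\<close> is odd, so \<open>8 * sqrt v\<close> is a primitive on both sides of the singularity.\<close>
  have "((\<lambda>v. 4 / \<bar>sqrt v\<bar>) has_integral (8 * sqrt 1 - 8 * sqrt (- 1))) {-1..1}"
  proof (rule fundamental_theorem_of_calculus_interior_strong[of "{0}" "- 1" 1 "\<lambda>v. 8 * sqrt v"])
    show "continuous_on {- 1..1} (\<lambda>v. 8 * sqrt v)" by (intro continuous_intros)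
    fix v :: real assume v: "v \<in> {- 1<..<1} - {0}"
    have "((\<lambda>v. 8 * sqrt v) has_real_derivative 4 / \<bar>sqrt v\<bar>) (at v)"
    proof (cases "v > 0")
      case True
      then have "(sqrt has_real_derivative inverse (sqrt v) / 2) (at v)"
        by (rule DERIV_real_sqrt)
      then have "((\<lambda>v. 8 * sqrt v) has_real_derivative 8 * (inverse (sqrt v) / 2)) (at v)"
        by (rule DERIV_cmult)
      also have "8 * (inverse (sqrt v) / 2) = 4 / \<bar>sqrt v\<bar>"
        using True by (simp add: inverse_eq_divide)
      finally show ?thesis .
    next
      case False
      then have "v < 0" using v by auto
      then have "(sqrt has_real_derivative - inverse (sqrt v) / 2) (at v)"
        using DERIV_real_sqrt_generic[of v "- inverse (sqrt v) / 2"] by simp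
      then have "((\<lambda>v. 8 * sqrt v) has_real_derivative 8 * (- inverse (sqrt v) / 2)) (at v)"
        by (rule DERIV_cmult)
      also have "8 * (- inverse (sqrt v) / 2) = 4 / \<bar>sqrt v\<bar>"
        using \<open>v < 0\<close> by (simp add: inverse_eq_divide)
      finally show ?thesis .
    qed
    then show "((\<lambda>v. 8 * sqrt v) has_vector_derivative 4 / \<bar>sqrt v\<bar>) (at v)"
      by (simp add: has_real_derivative_iff_has_vector_derivative)
  qed auto
  then have "((\<lambda>v. if v \<in> {-1..1} then 4 / \<bar>sqrt v\<bar> else 0) has_integral 16) UNIV"
    unfolding has_integral_restrict_UNIV by (simp add: real_sqrt_minus)
  then have "(\<integral>\<^sup>+v. ennreal (if v \<in> {-1..1} then 4 / \<bar>sqrt v\<bar> else 0) \<partial>lborel) = ennreal 16"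
    by (intro nn_integral_has_integral_lborel) auto
  also have "(\<lambda>v. ennreal (if v \<in> {-1..1} then 4 / \<bar>sqrt v\<bar> else 0)) = (\<lambda>v. ennreal (4 / \<bar>sqrt v\<bar>) * indicator {-1..1} v)"
    by (auto simp: indicator_def)
  finally show ?thesis by simp
qed

text \<open>For angles uniform on an arc of length 1 all differences lie in [-1, 1], where the
  inverse square root bound applies; the inner integral is bounded uniformly in s.\<close>

lemma interaction_uniform_arc_finite: "interaction unit_uniform (\<lambda>s. s) < \<infinity>"
proof -
  interpret U: prob_space unit_uniform by (rule prob_space_unit_uniform)
  have [measurable]: "(\<lambda>s. s) \<in> borel_measurable unit_uniform"
    by (rule measurable_restrict_space1) simp
  have inner: "(\<integral>\<^sup>+s'. log_kernel (s - s') \<partial>unit_uniform) \<le> 16" if s: "s \<in> {0<..<1}" for s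
  proof -
    have "(\<integral>\<^sup>+s'. log_kernel (s - s') \<partial>unit_uniform)
        = (\<integral>\<^sup>+s'. log_kernel (s - s') * indicator {0<..<1} s' \<partial>lborel)"
      by (rule nn_integral_unit_uniform)
    also have "\<dots> \<le> (\<integral>\<^sup>+s'. ennreal (4 / \<bar>sqrt (s + - 1 * s')\<bar>) * indicator {-1..1} (s + - 1 * s') \<partial>lborel)"
    proof (rule nn_integral_mono_AE)
      show "AE s' in lborel. log_kernel (s - s') * indicator {0<..<1} s'
          \<le> ennreal (4 / \<bar>sqrt (s + - 1 * s')\<bar>) * indicator {-1..1} (s + - 1 * s')"
        \<comment> \<open>The point s' = s is discarded: there the kernel is infinite, while the
          majorant is 0 by \<open>x / 0 = 0\<close>.\<close>
        using AE_lborel_singleton[of s]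
      proof eventually_elim
        case (elim s')
        then show ?case
          using s log_kernel_le_inverse_sqrt[of "s - s'"] by (auto simp: indicator_def)
      qed
    qed
    also have "\<dots> = (\<integral>\<^sup>+v. ennreal (4 / \<bar>sqrt v\<bar>) * indicator {-1..1} v \<partial>lborel)"
      by (subst (2) nn_integral_real_affine[where c = "- 1" and t = s]) auto
    finally show ?thesis unfolding integral_inverse_sqrt_finite .
  qed
  have "interaction unit_uniform (\<lambda>s. s) = (\<integral>\<^sup>+s. \<integral>\<^sup>+s'. log_kernel (s - s') \<partial>unit_uniform \<partial>unit_uniform)"
    unfolding interaction_def
    by (subst U.nn_integral_fst[symmetric]) (auto simp: case_prod_unfold)
  also have "\<dots> \<le> (\<integral>\<^sup>+s. 16 \<partial>unit_uniform)"
    by (intro nn_integral_mono inner) (simp add: space_unit_uniform)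
  also have "\<dots> = 16"
    using U.emeasure_space_1 by (simp add: space_unit_uniform)
  also have "\<dots> < \<infinity>" by simp
  finally show ?thesis .
qed

text \<open>From below, the potential is bounded and the interaction nonnegative; from above, the
  uniform law on the unit arc is a competitor of finite energy.\<close>

lemma min_energy_finite:
  assumes Q: "continuous_on UNIV (\<lambda>x. Q (cis x))"
  shows "\<bar>min_energy Q\<bar> \<noteq> \<infinity>"
proof -
  interpret U: prob_space unit_uniform by (rule prob_space_unit_uniform)
  obtain B where B: "\<And>x. \<bar>Q (cis x)\<bar> \<le> B" using bounded_on_circle[OF Q] by blast
  have lower: "ereal (- B - ln 2) \<le> energy Q N" if N: "N \<in> borel_prob_measures circle" for N
  proof -
    obtain G where G: "circle_lift G" "arc_law unit_uniform G = N"
      using ex_circle_lift[OF N] .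
    have [measurable]: "G \<in> borel_measurable unit_uniform"
      using circle_lift_measurable[OF G(1)] by (intro measurable_restrict_space1) simp
    have "- B \<le> (\<integral>s. Q (cis (G s)) \<partial>unit_uniform)"
    proof (rule U.integral_ge_const)
      show "integrable unit_uniform (\<lambda>s. Q (cis (G s)))"
        by (rule U.integrable_const_bound[of _ B])
           (use B in \<open>auto intro!: measurable_compose[OF _ borel_measurable_continuous_onI[OF Q]]\<close>)
      show "AE s in unit_uniform. - B \<le> Q (cis (G s))"
        using B by (intro AE_I2) (simp add: abs_le_iff minus_le_iff)
    qed
    then have "ereal (- B - ln 2) + 0 \<le> ereal ((\<integral>s. Q (cis (G s)) \<partial>unit_uniform) - ln 2) + enn2ereal (interaction unit_uniform G)"
      by (intro add_mono) auto
    then show ?thesis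
      unfolding G(2)[symmetric] by (simp add: U.energy_arc_law[OF _ Q])
  qed
  have m: "(\<lambda>s. s) \<in> borel_measurable unit_uniform"
    by (rule measurable_restrict_space1) simp
  have "min_energy Q \<le> energy Q (arc_law unit_uniform (\<lambda>s. s))"
    unfolding min_energy_def
    by (intro INF_lower arc_law_in_borel_prob_measures prob_space_unit_uniform m)
  also have "\<dots> < \<infinity>"
    using interaction_uniform_arc_finite
    by (cases "interaction unit_uniform (\<lambda>s. s)") (auto simp: U.energy_arc_law[OF m Q])
  finally have "min_energy Q \<noteq> \<infinity>" by simp
  moreover have "ereal (- B - ln 2) \<le> min_energy Q"
    unfolding min_energy_def by (intro INF_greatest lower)
  then have "min_energy Q \<noteq> - \<infinity>" by auto
  ultimately show ?thesis by auto
qed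

text \<open>The bounded potential passes to the limit by dominated convergence; the interaction can
  only drop, by Fatou.\<close>

lemma (in prob_space) energy_lower_semicontinuous:
  assumes [measurable]: "\<And>n. Y n \<in> borel_measurable M" "Z \<in> borel_measurable M"
    and lim: "\<And>x. x \<in> space M \<Longrightarrow> (\<lambda>n. Y n x) \<longlonglongrightarrow> Z x"
    and Q: "continuous_on UNIV (\<lambda>x. Q (cis x))"
    and E: "(\<lambda>n. energy Q (arc_law M (Y n))) \<longlonglongrightarrow> ereal e"
  shows "energy Q (arc_law M Z) \<le> ereal e"
proof -
  obtain B where B: "\<And>x. \<bar>Q (cis x)\<bar> \<le> B" using bounded_on_circle[OF Q] by blast
  have [measurable]: "(\<lambda>x. Q (cis x)) \<in> borel_measurable borel"
    by (rule borel_measurable_continuous_onI[OF Q])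
  define q where "q n = (\<integral>s. Q (cis (Y n s)) \<partial>M) - ln 2" for n
  define q' where "q' = (\<integral>s. Q (cis (Z s)) \<partial>M) - ln 2"
  have "(\<lambda>n. \<integral>s. Q (cis (Y n s)) \<partial>M) \<longlonglongrightarrow> (\<integral>s. Q (cis (Z s)) \<partial>M)"
  proof (rule integral_dominated_convergence[where w = "\<lambda>_. B"])
    show "AE s in M. (\<lambda>n. Q (cis (Y n s))) \<longlonglongrightarrow> Q (cis (Z s))"
      using Q by (intro AE_I2 isCont_tendsto_compose[of _ "\<lambda>x. Q (cis x)"] lim)
        (simp add: continuous_on_eq_continuous_at)
  qed (use B in auto)
  then have q: "q \<longlonglongrightarrow> q'"
    unfolding q_def[abs_def] q'_def by (intro tendsto_intros)
  \<comment> \<open>The potential is real, so subtracting it isolates the interaction even where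
    that is infinite.\<close>
  have int_eq: "energy Q (arc_law M (Y n)) - ereal (q n) = enn2ereal (interaction M (Y n))" for n
    by (cases "enn2ereal (interaction M (Y n))") (auto simp: energy_arc_law[OF _ Q] q_def)
  have "(\<lambda>n. energy Q (arc_law M (Y n)) - ereal (q n)) \<longlonglongrightarrow> ereal e - ereal q'"
    by (intro tendsto_diff_ereal E tendsto_ereal q) auto
  then have lim_diff: "(\<lambda>n. enn2ereal (interaction M (Y n))) \<longlonglongrightarrow> ereal (e - q')"
    unfolding int_eq by simp
  \<comment> \<open>Without this sign, \<open>ennreal\<close> would truncate the limit to 0.\<close>
  have L: "0 \<le> e - q'"
    using tendsto_lowerbound[OF lim_diff, of 0] by simp
  then have lim_int: "(\<lambda>n. interaction M (Y n)) \<longlonglongrightarrow> ennreal (e - q')"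
    using tendsto_e2ennrealI[OF lim_diff] by simp
  have "interaction M Z \<le> (\<integral>\<^sup>+x. liminf (\<lambda>n. log_kernel (Y n (fst x) - Y n (snd x))) \<partial>(M \<Otimes>\<^sub>M M))"
    unfolding interaction_def case_prod_unfold
  proof (intro nn_integral_mono)
    fix x assume "x \<in> space (M \<Otimes>\<^sub>M M)"
    then have "(\<lambda>n. log_kernel (Y n (fst x) - Y n (snd x))) \<longlonglongrightarrow> log_kernel (Z (fst x) - Z (snd x))"
      by (intro tendsto_log_kernel tendsto_diff lim) (auto simp: space_pair_measure)
    then show "log_kernel (Z (fst x) - Z (snd x)) \<le> liminf (\<lambda>n. log_kernel (Y n (fst x) - Y n (snd x)))"
      by (simp add: lim_imp_Liminf)
  qed
  also have "\<dots> \<le> liminf (\<lambda>n. interaction M (Y n))"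
    unfolding interaction_def case_prod_unfold by (rule nn_integral_liminf) measurable
  also have "\<dots> = ennreal (e - q')"
    using lim_int by (simp add: lim_imp_Liminf)
  finally have "enn2ereal (interaction M Z) \<le> ereal (e - q')"
    using L by (metis enn2ereal_ennreal less_eq_ennreal.rep_eq)
  then have "ereal q' + enn2ereal (interaction M Z) \<le> ereal q' + ereal (e - q')"
    by (rule add_left_mono)
  then show ?thesis
    by (simp add: energy_arc_law[OF _ Q] q'_def)
qed

text \<open>Compactness is applied to angle laws on the line. A limit law may charge -pi as well as
  pi, which is harmless because only \<open>cis\<close> of the limit variable enters.\<close>

lemma ex_energy_minimizer:
  assumes Q: "continuous_on UNIV (\<lambda>x. Q (cis x))"
  shows "\<exists>N \<in> borel_prob_measures circle. energy Q N = min_energy Q"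
proof -
  obtain e where e: "min_energy Q = ereal e"
    using min_energy_finite[OF Q] by (cases "min_energy Q") auto
  \<comment> \<open>The point mass at 1 shows that the set of energies is nonempty, so a minimizing
    sequence exists.\<close>
  have "arc_law unit_uniform (\<lambda>_. 0) \<in> borel_prob_measures circle"
    by (intro arc_law_in_borel_prob_measures prob_space_unit_uniform) simp
  then have "energy Q ` borel_prob_measures circle \<noteq> {}" by blast
  from Inf_as_limit[OF this] obtain u where u: "\<And>n. u n \<in> energy Q ` borel_prob_measures circle"
      "u \<longlonglongrightarrow> ereal e"
    unfolding min_energy_def[symmetric] e by blast
  then have "\<forall>n. \<exists>N \<in> borel_prob_measures circle. u n = energy Q N" by blast
  then obtain N where N: "\<And>n. N n \<in> borel_prob_measures circle" "\<And>n. u n = energy Q (N n)"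
    by metis
  have pN: "prob_space (N n)" and sN: "sets (N n) = sets circle_borel" for n
    using N(1)[of n] by (auto simp: borel_prob_measures_def)
  have spN: "space (N n) = circle" for n
    using sets_eq_imp_space_eq[OF sN] by (simp add: space_restrict_space)
  have Arg_N [measurable]: "Arg \<in> borel_measurable (N n)" for n
    using measurable_restrict_space1[OF Arg_measurable] by (subst measurable_cong_sets[OF sN refl])
  define \<mu> where "\<mu> n = distr (N n) borel Arg" for n
  have dist: "real_distribution (\<mu> n)" for n
    unfolding \<mu>_def by (rule prob_space.real_distribution_distr[OF pN]) simp
  have "tight \<mu>"
    unfolding tight_def
  proof (intro conjI allI impI dist)
    fix \<epsilon> :: real assume "\<epsilon> > 0"
    have "measure (\<mu> n) {-pi<..pi} = 1" for n
    proof -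
      have "measure (\<mu> n) {-pi<..pi} = measure (N n) (space (N n))"
        unfolding \<mu>_def by (subst measure_distr)
          (auto intro!: arg_cong[where f = "measure (N n)"] Arg_le_pi mpi_less_Arg)
      then show ?thesis by (simp add: prob_space.prob_space[OF pN])
    qed
    then show "\<exists>a b. a < b \<and> (\<forall>n. 1 - \<epsilon> < measure (\<mu> n) {a<..b})"
      using \<open>\<epsilon> > 0\<close> by (intro exI[of _ "- pi"] exI[of _ pi]) simp
  qed
  from tight_imp_convergent_subsubsequence[OF this strict_mono_id] obtain r \<mu>'
    where r: "strict_mono r" and \<mu>': "real_distribution \<mu>'" "weak_conv_m (\<mu> \<circ> id \<circ> r) \<mu>'"
    by blast
  have "\<And>n. real_distribution ((\<mu> \<circ> id \<circ> r) n)" using dist by simp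
  from Skorohod[OF this \<mu>'] obtain \<Omega> :: "real measure" and Y Z where \<Omega>: "prob_space \<Omega>"
      and "\<forall>n. Y n \<in> borel_measurable \<Omega>" "\<forall>n. distr \<Omega> borel (Y n) = (\<mu> \<circ> id \<circ> r) n"
      and "Z \<in> measurable \<Omega> lborel" "\<forall>x \<in> space \<Omega>. (\<lambda>n. Y n x) \<longlonglongrightarrow> Z x"
    by blast
  then have Y: "\<And>n. Y n \<in> borel_measurable \<Omega>" "\<And>n. distr \<Omega> borel (Y n) = \<mu> (r n)"
      and Z: "Z \<in> borel_measurable \<Omega>" and lim: "\<And>x. x \<in> space \<Omega> \<Longrightarrow> (\<lambda>n. Y n x) \<longlonglongrightarrow> Z x"
    by simp_all
  \<comment> \<open>The angle determines the point, so the Skorohod variables reproduce the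
    minimizing measures themselves and hence their energies.\<close>
  have "arc_law \<Omega> (Y n) = N (r n)" for n
  proof -
    have "arc_law \<Omega> (Y n) = distr (\<mu> (r n)) circle_borel cis"
      unfolding arc_law_def Y(2)[symmetric] using Y(1)[of n] by (subst distr_distr) (auto simp: comp_def)
    also have "\<dots> = distr (N (r n)) circle_borel (\<lambda>z. cis (Arg z))"
      unfolding \<mu>_def by (subst distr_distr) (auto simp: comp_def)
    also have "\<dots> = distr (N (r n)) circle_borel (\<lambda>z. z)"
      by (intro distr_cong refl cis_Arg_unit) (simp add: spN)
    also have "\<dots> = N (r n)" by (rule distr_id2[OF sN[symmetric]])
    finally show ?thesis .
  qed
  then have "(\<lambda>n. energy Q (arc_law \<Omega> (Y n))) \<longlonglongrightarrow> ereal e"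
    using LIMSEQ_subseq_LIMSEQ[OF u(2) r] by (simp add: comp_def N(2))
  then have "energy Q (arc_law \<Omega> Z) \<le> min_energy Q"
    unfolding e by (intro prob_space.energy_lower_semicontinuous[OF \<Omega> Y(1) Z lim Q])
  moreover have mem: "arc_law \<Omega> Z \<in> borel_prob_measures circle"
    by (rule arc_law_in_borel_prob_measures[OF \<Omega> Z])
  then have "min_energy Q \<le> energy Q (arc_law \<Omega> Z)"
    unfolding min_energy_def by (rule INF_lower)
  ultimately show ?thesis
    using mem by (intro bexI[of _ "arc_law \<Omega> Z"]) auto
qed

section \<open>The transport inequality\<close>

text \<open>The joint law of the two circle points is an admissible coupling, and its chordal cost
  is at most the angular cost.\<close>

lemma (in prob_space) W2_arc_law_le:
  fixes X Y :: "'a \<Rightarrow> real"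
  assumes [measurable]: "X \<in> borel_measurable M" "Y \<in> borel_measurable M"
    and int: "integrable M (\<lambda>s. (X s - Y s)\<^sup>2)"
  shows "(W2 (arc_law M X) (arc_law M Y))\<^sup>2 \<le> expectation (\<lambda>s. (X s - Y s)\<^sup>2)"
proof -
  let ?T2 = "restrict_space borel (circle \<times> circle) :: (complex \<times> complex) measure"
  let ?c = "\<lambda>\<pi>. \<integral>(x, y). (cmod (x - y))\<^sup>2 \<partial>\<pi>"
  have cis_borel: "(\<lambda>s. cis (W s)) \<in> borel_measurable M" if "W \<in> borel_measurable M" for W
    using measurable_compose[OF that borel_measurable_continuous_onI[OF continuous_on_cis[OF continuous_on_id]]] .
  have XY [measurable]: "(\<lambda>s. (cis (X s), cis (Y s))) \<in> measurable M ?T2"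
    by (intro measurable_restrict_space2 borel_measurable_Pair cis_borel assms) auto
  define \<pi> where "\<pi> = distr M ?T2 (\<lambda>s. (cis (X s), cis (Y s)))"
  have proj: "fst \<in> measurable ?T2 circle_borel" "snd \<in> measurable ?T2 circle_borel"
    by (rule measurable_restrict_space2,
        force simp: space_restrict_space,
        intro measurable_restrict_space1 borel_measurable_continuous_onI continuous_intros)+
  have "distr \<pi> circle_borel fst = arc_law M X" "distr \<pi> circle_borel snd = arc_law M Y"
    unfolding \<pi>_def arc_law_def by (subst distr_distr[OF proj(1) XY] distr_distr[OF proj(2) XY], simp add: comp_def)+
  then have mem: "\<pi> \<in> couplings (arc_law M X) (arc_law M Y)"
    by (auto simp: couplings_def borel_prob_measures_def \<pi>_def intro!: prob_space_distr)
  have nonneg: "0 \<le> ?c \<pi>'" for \<pi>'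
    by (intro Bochner_Integration.integral_nonneg) auto
  \<comment> \<open>The infimum is over a nonempty set by \<open>mem\<close> and is nonnegative, so
    squaring undoes the root in \<open>W2\<close>.\<close>
  have "0 \<le> (INF \<pi>'\<in>couplings (arc_law M X) (arc_law M Y). ?c \<pi>')"
    using mem nonneg by (intro cINF_greatest) auto
  then have "(W2 (arc_law M X) (arc_law M Y))\<^sup>2 = (INF \<pi>'\<in>couplings (arc_law M X) (arc_law M Y). ?c \<pi>')"
    by (simp add: W2_def)
  also have "\<dots> \<le> ?c \<pi>"
    using mem nonneg by (intro cINF_lower bdd_belowI[of _ 0]) auto
  also have "\<dots> = (\<integral>s. (cmod (cis (X s) - cis (Y s)))\<^sup>2 \<partial>M)"
  proof -
    have "(\<lambda>(x, y). (cmod (x - y))\<^sup>2) \<in> borel_measurable ?T2"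
      unfolding case_prod_unfold
      by (intro measurable_restrict_space1 borel_measurable_continuous_onI continuous_intros)
    then show ?thesis
      unfolding \<pi>_def by (subst integral_distr[OF XY]) auto
  qed
  also have "\<dots> \<le> expectation (\<lambda>s. (X s - Y s)\<^sup>2)"
  proof (intro integral_mono int)
    have le: "(cmod (cis (X s) - cis (Y s)))\<^sup>2 \<le> (X s - Y s)\<^sup>2" for s
      using power_mono[OF cmod_cis_diff_le[of "X s" "Y s"], of 2] by simp
    then show "integrable M (\<lambda>s. (cmod (cis (X s) - cis (Y s)))\<^sup>2)"
      by (intro Bochner_Integration.integrable_bound[OF int]) (use cis_borel assms in auto)
    show "(cmod (cis (X s) - cis (Y s)))\<^sup>2 \<le> (X s - Y s)\<^sup>2" for s by (rule le)
  qed
  finally show ?thesis .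
qed

text \<open>For a lift \<open>G\<close> the function \<open>G s - 2 \<pi> s\<close> is periodic, so rotating \<open>G\<close> by \<open>\<theta>\<close> shifts its mean
  by \<open>2 \<pi> \<theta>\<close>; hence two lifts can be rotated to have equal means.\<close>
lemma ex_centered_lifts:
  assumes "N \<in> borel_prob_measures circle" "N' \<in> borel_prob_measures circle"
  obtains G H where "circle_lift G" "arc_law unit_uniform G = N"
    "circle_lift H" "arc_law unit_uniform H = N'"
    "(\<integral>s. G s - H s \<partial>unit_uniform) = 0"
proof -
  interpret U: prob_space unit_uniform by (rule prob_space_unit_uniform)
  obtain G where G: "circle_lift G" "arc_law unit_uniform G = N" using ex_circle_lift[OF assms(1)] .
  obtain H where H: "circle_lift H" "arc_law unit_uniform H = N'" using ex_circle_lift[OF assms(2)] .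
  have U_meas: "f \<in> borel_measurable unit_uniform" if "f \<in> borel_measurable borel" for f :: "real \<Rightarrow> real"
    by (rule measurable_restrict_space1) (simp add: that)
  have int: "integrable unit_uniform F" if F: "circle_lift F" for F
  proof -
    obtain C where "\<And>s. s \<in> {0<..<1} \<Longrightarrow> \<bar>F s\<bar> \<le> C" using circle_lift_bounded[OF F] by blast
    then show ?thesis
      by (intro U.integrable_const_bound[of _ C] AE_I2 U_meas circle_lift_measurable[OF F])
         (simp add: space_unit_uniform)
  qed
  have int_id: "integrable unit_uniform (\<lambda>s. c * s + d)" for c d :: real
  proof -
    have "integrable unit_uniform (\<lambda>s. s)"
      by (intro U.integrable_const_bound[of _ 1] AE_I2 U_meas) (auto simp: space_unit_uniform)
    then show ?thesis by auto
  qed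
  define \<theta> where "\<theta> = ((\<integral>s. G s \<partial>unit_uniform) - (\<integral>s. H s \<partial>unit_uniform)) / (2 * pi)"
  define H' where "H' s = H (s + \<theta>)" for s
  have H': "circle_lift H'"
    unfolding H'_def using circle_lift_shift[OF H(1)] .
  have law: "arc_law unit_uniform H' = N'"
  proof -
    have "cis (H (s + 1)) = cis (H s)" for s
    proof -
      have "cis (H (s + 1)) = cis (H s + 2 * pi)"
        using H(1) by (simp only: circle_lift_def)
      also have "\<dots> = cis (H s) * cis (2 * pi)"
        by (rule cis_mult[symmetric])
      finally show ?thesis by simp
    qed
    then have "arc_law unit_uniform H' = arc_law unit_uniform H"
      unfolding arc_law_def H'_def
      by (rule distr_periodic_shift[OF cis_measurable_circle[OF circle_lift_measurable[OF H(1)]]])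
    then show ?thesis using H(2) by simp
  qed
  define P where "P s = H s - 2 * pi * s" for s
  have P [measurable]: "P \<in> borel_measurable borel"
    unfolding P_def using circle_lift_measurable[OF H(1)] by measurable
  have "P (s + 1) = P s" for s
  proof -
    have "H (s + 1) = H s + 2 * pi" using H(1) by (simp add: circle_lift_def)
    then show ?thesis by (simp add: P_def distrib_left)
  qed
  then have dP: "distr unit_uniform borel (\<lambda>s. P (s + \<theta>)) = distr unit_uniform borel P"
    by (rule distr_periodic_shift[OF P])
  have "(\<lambda>s. P (s + \<theta>)) \<in> borel_measurable borel" by measurable
  then have mP: "(\<lambda>s. P (s + \<theta>)) \<in> borel_measurable unit_uniform" "P \<in> borel_measurable unit_uniform"
    using P by (auto intro: U_meas)
  \<comment> \<open>A mean depends only on the law, and \<open>dP\<close> says that the shifted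
    periodic part has the same law.\<close>
  have P_mean: "(\<integral>s. P (s + \<theta>) \<partial>unit_uniform) = (\<integral>s. P s \<partial>unit_uniform)"
    using integral_distr[OF mP(1), of "\<lambda>x. x"] integral_distr[OF mP(2), of "\<lambda>x. x"]
    unfolding dP by simp
  have "(\<integral>s. H' s \<partial>unit_uniform) = (\<integral>s. P (s + \<theta>) + (2 * pi * s + 2 * pi * \<theta>) \<partial>unit_uniform)"
    by (simp add: P_def H'_def algebra_simps)
  also have "\<dots> = (\<integral>s. P (s + \<theta>) \<partial>unit_uniform) + (\<integral>s. 2 * pi * s + 2 * pi * \<theta> \<partial>unit_uniform)"
  proof (rule Bochner_Integration.integral_add)
    have "(\<lambda>s. P (s + \<theta>)) = (\<lambda>s. H' s - (2 * pi * s + 2 * pi * \<theta>))"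
      by (simp add: P_def H'_def fun_eq_iff algebra_simps)
    then show "integrable unit_uniform (\<lambda>s. P (s + \<theta>))"
      using int[OF H'] int_id by simp
  qed (rule int_id)
  also have "(\<integral>s. P (s + \<theta>) \<partial>unit_uniform) = (\<integral>s. H s \<partial>unit_uniform) - (\<integral>s. 2 * pi * s + 0 \<partial>unit_uniform)"
    unfolding P_mean unfolding P_def using int[OF H(1)] int_id[of "2 * pi" 0] by simp
  also have "(\<integral>s. 2 * pi * s + 2 * pi * \<theta> \<partial>unit_uniform) = (\<integral>s. 2 * pi * s + 0 \<partial>unit_uniform) + 2 * pi * \<theta>"
    using int_id[of "2 * pi" 0] U.prob_space by simp
  finally have "(\<integral>s. H' s \<partial>unit_uniform) = (\<integral>s. G s \<partial>unit_uniform)"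
    by (simp add: \<theta>_def)
  then have "(\<integral>s. G s - H' s \<partial>unit_uniform) = 0"
    using int[OF G(1)] int[OF H'] by simp
  then show ?thesis using that[OF G H' law] by blast
qed

text \<open>Bounding the L2 distance of lifts instead of \<open>W2\<close> serves both the transport
  inequality and uniqueness.\<close>

lemma energy_gap_lifts:
  assumes conv: "convex_on UNIV (\<lambda>x. Q (cis x) - \<rho> * x\<^sup>2)"
    and Q: "continuous_on UNIV (\<lambda>x. Q (cis x))"
    and N: "N \<in> borel_prob_measures circle" "energy Q N = min_energy Q"
    and N': "N' \<in> borel_prob_measures circle" "energy Q N' = ereal b"
  obtains X Y where "X \<in> borel_measurable unit_uniform" "Y \<in> borel_measurable unit_uniform"
    "arc_law unit_uniform X = N'" "arc_law unit_uniform Y = N"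
    "integrable unit_uniform (\<lambda>s. (X s - Y s)\<^sup>2)"
    "ereal ((\<rho> + 1 / 4) * (\<integral>s. (X s - Y s)\<^sup>2 \<partial>unit_uniform)) \<le> ereal b - min_energy Q"
proof -
  interpret U: prob_space unit_uniform by (rule prob_space_unit_uniform)
  obtain a where a: "min_energy Q = ereal a"
    using min_energy_finite[OF Q] by (cases "min_energy Q") auto
  obtain Y X where Y: "circle_lift Y" "arc_law unit_uniform Y = N"
    and X: "circle_lift X" "arc_law unit_uniform X = N'"
    and mean: "(\<integral>s. Y s - X s \<partial>unit_uniform) = 0"
    using ex_centered_lifts[OF N(1) N'(1)] .
  have meas [measurable]: "X \<in> borel_measurable unit_uniform" "Y \<in> borel_measurable unit_uniform"
    using circle_lift_measurable[OF X(1)] circle_lift_measurable[OF Y(1)]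
    by (auto intro: measurable_restrict_space1)
  obtain C\<^sub>1 where C1: "\<And>s. s \<in> {0<..<1} \<Longrightarrow> \<bar>X s\<bar> \<le> C\<^sub>1" using circle_lift_bounded[OF X(1)] by blast
  obtain C\<^sub>2 where C2: "\<And>s. s \<in> {0<..<1} \<Longrightarrow> \<bar>Y s\<bar> \<le> C\<^sub>2" using circle_lift_bounded[OF Y(1)] by blast
  define C where "C = max C\<^sub>1 C\<^sub>2"
  have C: "\<bar>X s\<bar> \<le> C" "\<bar>Y s\<bar> \<le> C" if "s \<in> space unit_uniform" for s
    using C1[of s] C2[of s] that by (auto simp: C_def space_unit_uniform)
  have order: "(Y s - Y s' \<in> {0..2 * pi} \<and> X s - X s' \<in> {0..2 * pi}) \<or>
      (Y s' - Y s \<in> {0..2 * pi} \<and> X s' - X s \<in> {0..2 * pi})"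
    if "s \<in> space unit_uniform" "s' \<in> space unit_uniform" for s s'
  proof (cases "s' \<le> s")
    case True
    with that show ?thesis
      by (intro disjI1 conjI circle_lift_diff X(1) Y(1)) (auto simp: space_unit_uniform)
  next
    case False
    with that show ?thesis
      by (intro disjI2 conjI circle_lift_diff X(1) Y(1)) (auto simp: space_unit_uniform)
  qed
  have "\<bar>X s - Y s\<bar> \<le> 2 * C" if "s \<in> space unit_uniform" for s
    using C[OF that] by linarith
  then have int: "integrable unit_uniform (\<lambda>s. (X s - Y s)\<^sup>2)"
    by (intro U.integrable_square_bounded) auto
  \<comment> \<open>In \<open>energy_minimizer_gap\<close> the minimizer comes first, so the lifts
    enter in swapped order; the square makes the sign immaterial.\<close>
  have "(\<rho> + 1 / 4) * (\<integral>s. (Y s - X s)\<^sup>2 \<partial>unit_uniform) \<le> b - a"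
    by (rule U.energy_minimizer_gap[OF meas(2,1) C(2,1) order mean conv Q])
       (use X(2) Y(2) N(2) N'(2) a in simp_all)
  then show ?thesis
    using that[OF meas X(2) Y(2) int] by (simp add: a power2_commute)
qed

theorem theorem2p11:
  fixes \<rho> :: real and Q :: "complex \<Rightarrow> real"
  assumes "\<rho> > - 1 / 4"
    and "convex_on UNIV (\<lambda>x::real. Q (cis x) - \<rho> * x\<^sup>2)"
  shows "(\<forall>\<nu>\<^sub>Q \<in> borel_prob_measures \<bbbT>. energy Q \<nu>\<^sub>Q = min_energy Q \<longrightarrow>
            (\<forall>\<nu> \<in> borel_prob_measures \<bbbT>.
               ereal ((\<rho> + 1 / 4) * (W2 \<nu> \<nu>\<^sub>Q)\<^sup>2) \<le> energy Q \<nu> - min_energy Q)) \<and>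
         (\<exists>!\<nu>\<^sub>Q. \<nu>\<^sub>Q \<in> borel_prob_measures \<bbbT> \<and> energy Q \<nu>\<^sub>Q = min_energy Q)"
proof -
  interpret U: prob_space unit_uniform by (rule prob_space_unit_uniform)
  \<comment> \<open>A real convex function on the whole line is continuous, and adding back the
    quadratic keeps this.\<close>
  have "continuous_on UNIV (\<lambda>x. (Q (cis x) - \<rho> * x\<^sup>2) + \<rho> * x\<^sup>2)"
    by (intro continuous_on_add convex_on_continuous[OF open_UNIV assms(2)] continuous_intros)
  then have Q: "continuous_on UNIV (\<lambda>x. Q (cis x))" by simp
  obtain a where a: "min_energy Q = ereal a"
    using min_energy_finite[OF Q] by (cases "min_energy Q") auto
  have gap: "ereal ((\<rho> + 1 / 4) * (W2 \<nu> N)\<^sup>2) \<le> energy Q \<nu> - min_energy Q"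
    if N: "N \<in> borel_prob_measures \<bbbT>" "energy Q N = min_energy Q" and \<nu>: "\<nu> \<in> borel_prob_measures \<bbbT>"
    for N \<nu>
  proof (cases "energy Q \<nu>")
    case (real b)
    obtain X Y where XY: "X \<in> borel_measurable unit_uniform" "Y \<in> borel_measurable unit_uniform"
        "arc_law unit_uniform X = \<nu>" "arc_law unit_uniform Y = N"
        "integrable unit_uniform (\<lambda>s. (X s - Y s)\<^sup>2)"
        "ereal ((\<rho> + 1 / 4) * (\<integral>s. (X s - Y s)\<^sup>2 \<partial>unit_uniform)) \<le> ereal b - min_energy Q"
      using energy_gap_lifts[OF assms(2) Q N \<nu> real] .
    have "(\<rho> + 1 / 4) * (W2 \<nu> N)\<^sup>2 \<le> (\<rho> + 1 / 4) * (\<integral>s. (X s - Y s)\<^sup>2 \<partial>unit_uniform)"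
      using U.W2_arc_law_le[OF XY(1,2,5)] assms(1) XY(3,4) by (intro mult_left_mono) auto
    then have "ereal ((\<rho> + 1 / 4) * (W2 \<nu> N)\<^sup>2)
        \<le> ereal ((\<rho> + 1 / 4) * (\<integral>s. (X s - Y s)\<^sup>2 \<partial>unit_uniform))"
      by simp
    also note XY(6)
    finally show ?thesis by (simp add: real)
  next
    \<comment> \<open>This contradicts the finiteness of the minimal energy; for energy \<infinity>,
      the same finiteness makes the right side infinite.\<close>
    case MInf
    moreover have "min_energy Q \<le> energy Q \<nu>"
      unfolding min_energy_def by (rule INF_lower[OF \<nu>])
    ultimately show ?thesis by (simp add: a)
  qed (simp add: a)
  \<comment> \<open>With zero energy gap and \<rho> + 1/4 > 0, the two lifts agree almost
    everywhere, so their laws coincide. This avoids proving that \<open>W2\<close> separates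
    measures.\<close>
  have unique: "N' = N"
    if N: "N \<in> borel_prob_measures \<bbbT>" "energy Q N = min_energy Q"
      and N': "N' \<in> borel_prob_measures \<bbbT>" "energy Q N' = min_energy Q" for N N'
  proof -
    obtain X Y where XY: "X \<in> borel_measurable unit_uniform" "Y \<in> borel_measurable unit_uniform"
        "arc_law unit_uniform X = N'" "arc_law unit_uniform Y = N"
        "integrable unit_uniform (\<lambda>s. (X s - Y s)\<^sup>2)"
        "ereal ((\<rho> + 1 / 4) * (\<integral>s. (X s - Y s)\<^sup>2 \<partial>unit_uniform)) \<le> ereal a - min_energy Q"
      using energy_gap_lifts[OF assms(2) Q N N'(1) N'(2)[unfolded a]] .
    have "(\<rho> + 1 / 4) * (\<integral>s. (X s - Y s)\<^sup>2 \<partial>unit_uniform) \<le> 0"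
      using XY(6) by (simp add: a)
    then have "(\<integral>s. (X s - Y s)\<^sup>2 \<partial>unit_uniform) \<le> 0"
      using assms(1) by (simp add: mult_le_0_iff)
    then have "(\<integral>s. (X s - Y s)\<^sup>2 \<partial>unit_uniform) = 0"
      by (intro antisym) auto
    then have "AE s in unit_uniform. (X s - Y s)\<^sup>2 = 0"
      using integral_nonneg_eq_0_iff_AE[OF XY(5)] by simp
    then have eq: "AE s in unit_uniform. cis (X s) = cis (Y s)"
      by eventually_elim simp
    have "arc_law unit_uniform X = arc_law unit_uniform Y"
      unfolding arc_law_def
      by (intro distr_cong_AE refl eq cis_measurable_circle XY(1,2))
    then show ?thesis using XY(3,4) by simp
  qed
  show ?thesis
    using gap unique ex_energy_minimizer[OF Q] by blast
qed

end
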